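(* Let $M$ be a closed program and let $M=M_0\overset{p}{\rightsquigarrow}M_1\overset{p}{\rightsquigarrow}\cdots$ be a computation of $M$. Then $\bigsqcup_{i\in\mathbb{N}}(M_i)_D\in\mathrm{data}([\![M]\!])$.
   Context: $D$ is the Scott domain solving $D=(\mathbf{Nil}+\mathbf{Left}(D)+\mathbf{Right}(D)+\mathbf{Pair}(D\times D)+\mathbf{Amb}(D\times D)+\mathbf{Fun}(D\to D))_\bot$ (separated sum, product, continuous function space); data constructors are $\mathbf{Nil},\mathbf{Left},\mathbf{Right},\mathbf{Pair}$; constructors are these and $\mathbf{Amb}$. Programs: $M,N,L,R ::= a \mid \lambda a.M \mid M\,N \mid M{\downarrow}N \mid \mathbf{rec}\,M \mid \bot \mid \mathbf{Nil} \mid \mathbf{Left}(M) \mid \mathbf{Right}(M) \mid \mathbf{Pair}(M,N) \mid \mathbf{Amb}(M,N) \mid \mathbf{case}\,M\,\mathbf{of}\,\{\mathbf{Left}(a)\to L;\mathbf{Right}(b)\to R\} \mid \mathbf{case}\,M\,\mathbf{of}\,\{\mathbf{Pair}(a,b)\to N\}\mid \mathbf{case}\,M\,\mathbf{of}\,\{\mathbf{Amb}(a,b)\to N\}$. Denotation $[\![M]\!]\eta\in D$ ($\eta$ assigns elements of $D$ to variables; for closed $M$ written $[\![M]\!]$): $[\![a]\!]\eta=\eta(a)$; $[\![\lambda a.M]\!]\eta=\mathbf{Fun}(f)$ with $f(d)=[\![M]\!]\eta[a\mapsto d]$; $[\![M\,N]\!]\eta=f([\![N]\!]\eta)$ if $[\![M]\!]\eta=\mathbf{Fun}(f)$;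 $[\![M{\downarrow}N]\!]\eta=f([\![N]\!]\eta)$ if $[\![M]\!]\eta=\mathbf{Fun}(f)$ and $[\![N]\!]\eta\ne\bot$; $[\![\mathbf{rec}\,M]\!]\eta$ is the least fixed point of $f$ if $[\![M]\!]\eta=\mathbf{Fun}(f)$; $[\![C(M_1,\dots,M_k)]\!]\eta=C([\![M_1]\!]\eta,\dots)$ for constructors $C$ (including $\mathbf{Amb}$); $[\![\mathbf{case}\,M\,\mathbf{of}\{\dots\}]\!]\eta=[\![K]\!]\eta[\vec a\mapsto\vec d]$ if $[\![M]\!]\eta=C(\vec d)$ and $C(\vec a)\to K$ is a clause; $\bot$ in all other cases. A weak head normal form (w.h.n.f.) is a program beginning with a constructor (including $\mathbf{Amb}$) or a $\lambda$-abstraction. A program is $\bot$-like if it is $\bot$, $C(\vec M)\,N$, $C(\vec M){\downarrow}N$, or $\mathbf{case}\,M'\,\mathbf{of}\{\dots\}$ with $M'$ a $\lambda$-abstraction or $M'=C(\vec M)$ where no clause has the form $C(\vec a)\to N$. The relation $\rightsquigarrow$ is the least relation with: $(\lambda a.M)\,N\rightsquigarrow M[N/a]$; $M\rightsquigarrow M'\Rightarrow M\,N\rightsquigarrow M'\,N$; $(\lambda a.M){\downarrow}N\rightsquigarrow M[N/a]$ if $N$ is a w.h.n.f.; if $N$ is a w.h.n.f. and $M\rightsquigarrow M'$ then $M{\downarrow}N\rightsquigarrow M'{\downarrow}N$; $N\rightsquigarrow N'\Rightarrow M{\downarrow}N\rightsquigarrow M{\downarrow}N'$; $\mathbf{rec}\,M\rightsquigarrow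 M\,(\mathbf{rec}\,M)$; $\mathbf{case}\,C(\vec M)\,\mathbf{of}\{\dots;C(\vec b)\to N;\dots\}\rightsquigarrow N[\vec M/\vec b]$ ($C$ any constructor including $\mathbf{Amb}$); $M\rightsquigarrow M'\Rightarrow \mathbf{case}\,M\,\mathbf{of}\{\vec{Cl}\}\rightsquigarrow\mathbf{case}\,M'\,\mathbf{of}\{\vec{Cl}\}$; $M\rightsquigarrow\bot$ if $M$ is $\bot$-like. The relation $\overset{c}{\rightsquigarrow}$: $M\rightsquigarrow M'\Rightarrow M\overset{c}{\rightsquigarrow}M'$; $M_1\rightsquigarrow M_1'\Rightarrow\mathbf{Amb}(M_1,M_2)\overset{c}{\rightsquigarrow}\mathbf{Amb}(M_1',M_2)$; $M_2\rightsquigarrow M_2'\Rightarrow\mathbf{Amb}(M_1,M_2)\overset{c}{\rightsquigarrow}\mathbf{Amb}(M_1,M_2')$; $\mathbf{Amb}(M_1,M_2)\overset{c}{\rightsquigarrow}M_1$ if $M_1$ is a w.h.n.f.; $\mathbf{Amb}(M_1,M_2)\overset{c}{\rightsquigarrow}M_2$ if $M_2$ is a w.h.n.f. The relation $\overset{p}{\rightsquigarrow}$: $M\overset{c}{\rightsquigarrow}M'\Rightarrow M\overset{p}{\rightsquigarrow}M'$; if $M_i\overset{p}{\rightsquigarrow}M_i'$ for $i=1,\dots,k$ then $C(M_1,\dots,M_k)\overset{p}{\rightsquigarrow}C(M_1',\dots,M_k')$ for a data constructor $C$ (so $\mathbf{Nil}\overset{p}{\rightsquigarrow}\mathbf{Nil}$);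 $\lambda a.M\overset{p}{\rightsquigarrow}\lambda a.M$. An infinite sequence $M_1\overset{p}{\rightsquigarrow}M_2\overset{p}{\rightsquigarrow}\cdots$ is unfair (inductive definition) if: each $M_i=\mathbf{Amb}(L_i,R)$ with fixed $R$ and $L_i\rightsquigarrow L_{i+1}$; or each $M_i=\mathbf{Amb}(L,R_i)$ with fixed $L$ and $R_i\rightsquigarrow R_{i+1}$; or each $M_i=C(N_{i,1},\dots,N_{i,n})$ for a fixed $n$-ary data constructor $C$ and $N_{1,k}\overset{p}{\rightsquigarrow}N_{2,k}\overset{p}{\rightsquigarrow}\cdots$ is unfair for some $k$; or its tail $M_2\overset{p}{\rightsquigarrow}M_3\cdots$ is unfair. It is fair if not unfair. A computation of $M$ is an infinite fair sequence $M=M_0\overset{p}{\rightsquigarrow}M_1\overset{p}{\rightsquigarrow}\cdots$. Define $M_D\in D$: $C(M_1,\dots,M_k)_D=C((M_1)_D,\dots,(M_k)_D)$ for data constructors $C$, $(\lambda a.M)_D=[\![\lambda a.M]\!]$, and $M_D=\bot$ otherwise (along a computation the $(M_i)_D$ increase). The relation $d\in\mathrm{data}(a)$ on $D$ is the largest relation such that $d\in\mathrm{data}(a)$ implies one of: $a=\mathbf{Amb}(a',b')$, $a'\ne\bot$, $d\in\mathrm{data}(a')$; or $a=\mathbf{Amb}(a',b')$, $b'\ne\bot$, $d\in\mathrm{data}(b')$; or $a=\mathbf{Amb}(\bot,\bot)$ and $d=\bot$; or $a=C(\vec{a'})$, $d=C(\vec{d'})$ for a data constructor $C$ with $d'_i\in\mathrm{data}(a'_i)$;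 or $a=\mathbf{Fun}(f)$ and $d=a$; or $a=d=\bot$. *)

theory Defs
  imports "HOL-Library.Complete_Partial_Order2" "HOL-Library.Countable"
begin

section \<open>Tokens\<close>

text \<open>
  The domain \<open>D\<close> is constructed as the set of ideals of an information system, i.e. of the consistent
  and deductively closed sets of tokens (finite pieces of information).  \<open>Tag c\<close> says that an element
  belongs to the summand \<open>c\<close>; \<open>Arg c i t\<close> that moreover its \<open>i\<close>-th component contains \<open>t\<close>;
  \<open>Step xs t\<close> that it is a function mapping every argument containing all of \<open>xs\<close> to a value
  containing \<open>t\<close>.  The element bottom is the empty ideal.  That the result is the canonical solution
  of the domain equation is shown by \<open>D_bounded_complete\<close>, \<open>el_compact\<close> and \<open>D_algebraic\<close> (Scott
  domain), \<open>D_le_iff\<close> and the constructor facts of \<open>free_constructors\<close> (isomorphism; \<open>cfun\<close> is the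
  type of continuous functions), and \<open>D_minimal\<close>.
\<close>

datatype tag = NilT | LeftT | RightT | PairT | AmbT | FunT

fun arity :: "tag \<Rightarrow> nat" where
  "arity LeftT = 1"
| "arity RightT = 1"
| "arity PairT = 2"
| "arity AmbT = 2"
| "arity _ = 0"

datatype tok = Tag tag | Arg tag nat tok | Step "tok list" tok

instance tag :: countable by countable_datatype
instance tok :: countable by countable_datatype

fun tag_of :: "tok \<Rightarrow> tag" where
  "tag_of (Tag c) = c"
| "tag_of (Arg c i t) = c"
| "tag_of (Step xs t) = FunT"

fun coh :: "tok \<Rightarrow> tok \<Rightarrow> bool" where
  "coh (Arg c i s) (Arg c' j t) \<longleftrightarrow> c = c' \<and> (i = j \<longrightarrow> coh s t)"
| "coh (Step xs s) (Step ys t) \<longleftrightarrow> ((\<forall>x\<in>set xs. \<forall>y\<in>set ys. coh x y) \<longrightarrow> coh s t)"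
| "coh s t \<longleftrightarrow> tag_of s = tag_of t"

fun wf_tok :: "tok \<Rightarrow> bool" where
  "wf_tok (Tag c) \<longleftrightarrow> True"
| "wf_tok (Arg c i t) \<longleftrightarrow> i < arity c \<and> wf_tok t"
| "wf_tok (Step xs t) \<longleftrightarrow>
    (\<forall>x\<in>set xs. wf_tok x) \<and> (\<forall>x\<in>set xs. \<forall>y\<in>set xs. coh x y) \<and> wf_tok t"

inductive entails :: "tok set \<Rightarrow> tok \<Rightarrow> bool" (infix "\<turnstile>" 50) where
  Tag: "t \<in> X \<Longrightarrow> X \<turnstile> Tag (tag_of t)"
| Arg: "{t. Arg c i t \<in> X} \<turnstile> t \<Longrightarrow> X \<turnstile> Arg c i t"
| Step: "Y \<turnstile> t \<Longrightarrow> (\<And>y. y \<in> Y \<Longrightarrow> \<exists>zs. Step zs y \<in> X \<and> (\<forall>z\<in>set zs. set xs \<turnstile> z)) \<Longrightarrow> X \<turnstile> Step xs t"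

inductive_cases entails_TagE: "X \<turnstile> Tag c"
inductive_cases entails_ArgE: "X \<turnstile> Arg c i t"
inductive_cases entails_StepE: "X \<turnstile> Step xs t"

definition ideal :: "tok set \<Rightarrow> bool" where
  "ideal u \<longleftrightarrow> (\<forall>t\<in>u. wf_tok t) \<and> (\<forall>s\<in>u. \<forall>t\<in>u. coh s t) \<and> (\<forall>t. wf_tok t \<longrightarrow> u \<turnstile> t \<longrightarrow> t \<in> u)"

lemma coh_tag_of: "coh s t \<Longrightarrow> tag_of s = tag_of t"
  by (cases s; cases t) auto

lemma coh_refl: "coh t t"
  by (induction t) auto

lemma coh_sym: "coh s t \<longleftrightarrow> coh t s"
  by (induction s t rule: coh.induct) (auto simp: eq_commute)

lemma entails_tag_of: "X \<turnstile> t \<Longrightarrow> \<exists>x\<in>X. tag_of x = tag_of t"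
proof (induction rule: entails.induct)
  case (Step Y t X xs)
  then show ?case by (metis tag_of.simps(3))
next
  case (Arg c i X t)
  then show ?case by (metis mem_Collect_eq tag_of.simps(2))
qed auto

lemma not_entails_empty [simp]: "\<not> {} \<turnstile> t"
  using entails_tag_of by blast

lemma entails_mono: "X \<turnstile> t \<Longrightarrow> X \<subseteq> X' \<Longrightarrow> X' \<turnstile> t"
proof (induction arbitrary: X' rule: entails.induct)
  case (Tag t X)
  then show ?case by (auto intro: entails.Tag)
next
  case (Arg c i X t)
  show ?case by (rule entails.Arg, rule Arg.IH) (use Arg.prems in auto)
next
  case (Step Y t X xs)
  show ?case
  proof (rule entails.Step[OF Step.hyps])
    fix y assume "y \<in> Y"
    then obtain zs where "Step zs y \<in> X" "\<forall>z\<in>set zs. set xs \<turnstile> z" using Step.IH(2) by blast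
    then show "\<exists>zs. Step zs y \<in> X' \<and> (\<forall>z\<in>set zs. set xs \<turnstile> z)" using Step.prems by blast
  qed
qed

lemma entails_refl: "t \<in> X \<Longrightarrow> X \<turnstile> t"
proof (induction t arbitrary: X)
  case (Tag c)
  then show ?case using entails.Tag by fastforce
next
  case (Arg c i t)
  then show ?case by (simp add: entails.Arg)
next
  case (Step xs t)
  show ?case
    by (rule entails.Step[where Y="{t}"]) (use Step in auto)
qed

lemma entails_compact: "X \<turnstile> t \<Longrightarrow> \<exists>F. finite F \<and> F \<subseteq> X \<and> F \<turnstile> t"
proof (induction rule: entails.induct)
  case (Tag t X)
  then show ?case
    by (intro exI[of _ "{t}"]) (auto intro: entails.Tag)
next
  case (Arg c i X t)
  then obtain F where F: "finite F" "F \<subseteq> {t. Arg c i t \<in> X}" "F \<turnstile> t" by blast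
  have "Arg c i ` F \<turnstile> Arg c i t"
    by (rule entails.Arg, rule entails_mono[OF F(3)]) auto
  with F show ?case by (intro exI[of _ "Arg c i ` F"]) auto
next
  case (Step Y t X xs)
  then obtain F where F: "finite F" "F \<subseteq> Y" "F \<turnstile> t" by blast
  have "\<forall>y\<in>F. \<exists>zs. Step zs y \<in> X \<and> (\<forall>z\<in>set zs. set xs \<turnstile> z)"
    using Step F by blast
  then obtain zs where zs: "\<And>y. y \<in> F \<Longrightarrow> Step (zs y) y \<in> X \<and> (\<forall>z\<in>set (zs y). set xs \<turnstile> z)"
    by metis
  have "(\<lambda>y. Step (zs y) y) ` F \<turnstile> Step xs t"
    by (rule entails.Step[OF F(3)]) (use zs in blast)
  with F zs show ?case by (intro exI[of _ "(\<lambda>y. Step (zs y) y) ` F"]) auto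
qed

lemma size_mem_Step: "x \<in> set xs \<Longrightarrow> size x < size (Step xs t)"
  by (induction xs) auto

lemma entails_cut_bounded:
  assumes "\<And>y. y \<in> Y \<Longrightarrow> X \<turnstile> y" "Y \<turnstile> t"
    "\<And>x. x \<in> X \<Longrightarrow> size x < n" "\<And>y. y \<in> Y \<Longrightarrow> size y < n" "size t < n"
  shows "X \<turnstile> t"
  using assms
proof (induction n arbitrary: X Y t)
  case (Suc n)
  show ?case
  proof (cases t)
    case (Tag c)
    then obtain y where "y \<in> Y" "tag_of y = c"
      using entails_tag_of[OF Suc.prems(2)] by auto
    then show ?thesis
      using Suc.prems(1) entails_tag_of entails.Tag Tag by metis
  next
    case (Arg c i s)
    have "{s. Arg c i s \<in> Y} \<turnstile> s" using Suc.prems(2) Arg by (auto elim: entails_ArgE)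
    moreover have "{s. Arg c i s \<in> X} \<turnstile> y" if "Arg c i y \<in> Y" for y
      using Suc.prems(1)[OF that] by (auto elim: entails_ArgE)
    moreover have "size s < n" if "Arg c i s \<in> X" for s
      using Suc.prems(3)[OF that] by simp
    moreover have "size s < n" if "Arg c i s \<in> Y" for s
      using Suc.prems(4)[OF that] by simp
    ultimately have "{s. Arg c i s \<in> X} \<turnstile> s"
      using Suc.IH[of "{s. Arg c i s \<in> Y}" "{s. Arg c i s \<in> X}" s] Suc.prems(5) Arg by auto
    then show ?thesis by (simp add: Arg entails.Arg)
  next
    case (Step xs s)
    obtain W where W: "W \<turnstile> s"
      "\<And>w. w \<in> W \<Longrightarrow> \<exists>zs. Step zs w \<in> Y \<and> (\<forall>z\<in>set zs. set xs \<turnstile> z)"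
      using Suc.prems(2) Step by (auto elim: entails_StepE)
    define V where "V = {v. \<exists>us. Step us v \<in> X \<and> (\<forall>u\<in>set us. set xs \<turnstile> u)}"
    have xs: "size x < n" if "x \<in> set xs" for x
      using size_mem_Step[OF that, of s] Suc.prems(5) Step by simp
    have V: "size v < n" if "v \<in> V" for v
      using that Suc.prems(3) unfolding V_def by fastforce
    have Ws: "size w < n" if "w \<in> W" for w
      using W(2)[OF that] Suc.prems(4) by fastforce
    have s: "size s < n" using Suc.prems(5) Step by simp
    have VW: "V \<turnstile> w" if w: "w \<in> W" for w
    proof -
      obtain zs where zs: "Step zs w \<in> Y" "\<forall>z\<in>set zs. set xs \<turnstile> z" using W(2)[OF w] by blast
      obtain V' where V': "V' \<turnstile> w"
        "\<And>v. v \<in> V' \<Longrightarrow> \<exists>us. Step us v \<in> X \<and> (\<forall>u\<in>set us. set zs \<turnstile> u)"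
        using Suc.prems(1)[OF zs(1)] by (auto elim: entails_StepE)
      have "V' \<subseteq> V"
      proof
        fix v assume "v \<in> V'"
        then obtain us where us: "Step us v \<in> X" "\<forall>u\<in>set us. set zs \<turnstile> u" using V' by blast
        have "set xs \<turnstile> u" if u: "u \<in> set us" for u
        proof (rule Suc.IH[of "set zs"])
          show "size u < n" using size_mem_Step[OF u, of v] Suc.prems(3)[OF us(1)] by simp
          show "size z < n" if "z \<in> set zs" for z
            using size_mem_Step[OF that, of w] Suc.prems(4)[OF zs(1)] by simp
        qed (use us zs u xs in auto)
        then show "v \<in> V" using us V_def by blast
      qed
      then show ?thesis using V' entails_mono by blast
    qed
    have "V \<turnstile> s" by (rule Suc.IH[OF VW W(1) V Ws s])
    then show ?thesis
      unfolding Step by (rule entails.Step) (auto simp: V_def)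
  qed
qed simp

lemma entails_cut:
  assumes "\<And>y. y \<in> Y \<Longrightarrow> X \<turnstile> y" "Y \<turnstile> t"
  shows "X \<turnstile> t"
proof -
  obtain F where F: "finite F" "F \<subseteq> Y" "F \<turnstile> t" using entails_compact[OF assms(2)] by blast
  have "\<forall>y\<in>F. \<exists>G. finite G \<and> G \<subseteq> X \<and> G \<turnstile> y"
    using F assms(1) entails_compact by blast
  then obtain G where G: "\<And>y. y \<in> F \<Longrightarrow> finite (G y) \<and> G y \<subseteq> X \<and> G y \<turnstile> y" by metis
  define H where "H = (\<Union>y\<in>F. G y)"
  have H: "finite H" "H \<subseteq> X"
    unfolding H_def using F G by auto
  have HF: "H \<turnstile> y" if "y \<in> F" for y
    by (rule entails_mono[of "G y"]) (use that G in \<open>auto simp: H_def\<close>)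
  have "H \<turnstile> t"
  proof (rule entails_cut_bounded[OF HF F(3)])
    let ?n = "Suc (Max (size ` (H \<union> F \<union> {t})))"
    have "size x < ?n" if "x \<in> H \<union> F \<union> {t}" for x
      unfolding less_Suc_eq_le by (rule Max_ge) (use that H F in blast)+
    then show "x \<in> H \<Longrightarrow> size x < ?n" "x \<in> F \<Longrightarrow> size x < ?n" "size t < ?n" for x
      by blast+
  qed
  then show ?thesis using H entails_mono by blast
qed

lemma entails_coh:
  assumes "X \<turnstile> s" "Y \<turnstile> t" "\<forall>x\<in>X. \<forall>y\<in>Y. coh x y"
  shows "coh s t"
  using assms
proof (induction arbitrary: Y t rule: entails.induct)
  case (Tag x X)
  then obtain y where "y \<in> Y" "tag_of y = tag_of t" using entails_tag_of by blast
  then have "tag_of x = tag_of t" using Tag coh_tag_of by metis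
  then show ?case by (cases t) auto
next
  case (Arg c i X s)
  obtain y where y: "y \<in> Y" "tag_of y = tag_of t" using Arg entails_tag_of by blast
  obtain x where x: "Arg c i x \<in> X" using entails_tag_of[OF Arg(1)] by auto
  have tag: "tag_of t = c" using coh_tag_of[of "Arg c i x" y] x y Arg.prems by simp
  show ?case
  proof (cases t)
    case t: (Arg c' j t')
    have "coh s t'" if "i = j"
    proof (rule Arg.IH)
      show "{t. Arg c' j t \<in> Y} \<turnstile> t'" using Arg.prems t by (auto elim: entails_ArgE)
      show "\<forall>x\<in>{t. Arg c i t \<in> X}. \<forall>y\<in>{t. Arg c' j t \<in> Y}. coh x y"
        using Arg.prems(2) that tag t by fastforce
    qed
    then show ?thesis using t tag by auto
  qed (use tag in auto)
next
  case (Step W s X xs)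
  obtain y where y: "y \<in> Y" "tag_of y = tag_of t" using Step entails_tag_of by blast
  obtain w where w: "w \<in> W" using entails_tag_of[OF Step(1)] by auto
  then obtain zs where zs: "Step zs w \<in> X" using Step by blast
  have tag: "tag_of t = FunT" using coh_tag_of[of "Step zs w" y] zs y Step.prems by simp
  show ?case
  proof (cases t)
    case t: (Step ys t')
    obtain V where V: "V \<turnstile> t'"
      "\<And>v. v \<in> V \<Longrightarrow> \<exists>us. Step us v \<in> Y \<and> (\<forall>u\<in>set us. set ys \<turnstile> u)"
      using Step.prems t by (auto elim: entails_StepE)
    have "coh s t'" if c: "\<forall>x\<in>set xs. \<forall>y\<in>set ys. coh x y"
    proof (rule Step.IH(1)[OF V(1)], intro ballI)
      fix w v assume "w \<in> W" "v \<in> V"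
      obtain us where us: "Step us v \<in> Y" "\<forall>u\<in>set us. set ys \<turnstile> u" using V \<open>v \<in> V\<close> by blast
      obtain zs where zs: "Step zs w \<in> X"
        "\<And>z. z \<in> set zs \<Longrightarrow> \<forall>Y t. Y \<turnstile> t \<longrightarrow> (\<forall>x\<in>set xs. \<forall>y\<in>Y. coh x y) \<longrightarrow> coh z t"
        using Step.IH(2)[OF \<open>w \<in> W\<close>] by blast
      have "\<forall>z\<in>set zs. \<forall>u\<in>set us. coh z u" using zs us c by blast
      moreover have "coh (Step zs w) (Step us v)" using zs us Step.prems by blast
      ultimately show "coh w v" by simp
    qed
    then show ?thesis using t by simp
  qed (use tag in auto)
qed

definition clos :: "tok set \<Rightarrow> tok set" where
  "clos X = {t. wf_tok t \<and> X \<turnstile> t}"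

definition consis :: "tok set \<Rightarrow> bool" where
  "consis X \<longleftrightarrow> (\<forall>x\<in>X. wf_tok x) \<and> (\<forall>x\<in>X. \<forall>y\<in>X. coh x y)"

lemma ideal_clos: "consis X \<Longrightarrow> ideal (clos X)"
proof -
  assume X: "consis X"
  have "coh s t" if "X \<turnstile> s" "X \<turnstile> t" for s t
    by (rule entails_coh[OF that]) (use X in \<open>simp add: consis_def\<close>)
  moreover have "X \<turnstile> t" if "clos X \<turnstile> t" for t
    by (rule entails_cut[OF _ that]) (simp add: clos_def)
  ultimately show "ideal (clos X)"
    by (simp add: ideal_def) (simp add: clos_def)
qed

lemma clos_incl: "consis X \<Longrightarrow> X \<subseteq> clos X"
  by (auto simp: clos_def consis_def entails_refl)

lemma clos_least: "ideal u \<Longrightarrow> X \<subseteq> u \<Longrightarrow> clos X \<subseteq> u"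
  unfolding clos_def ideal_def using entails_mono by blast

lemma clos_mono: "X \<subseteq> Y \<Longrightarrow> clos X \<subseteq> clos Y"
  unfolding clos_def using entails_mono by blast

lemma ideal_consis: "ideal u \<Longrightarrow> X \<subseteq> u \<Longrightarrow> consis X"
  by (auto simp: ideal_def consis_def subset_iff)

lemma wf_Step_iff: "wf_tok (Step xs t) \<longleftrightarrow> consis (set xs) \<and> wf_tok t"
  by (auto simp: consis_def)

lemma ideal_empty: "ideal {}"
  by (simp add: ideal_def)

section \<open>The domain D\<close>

typedef D = "{u. ideal u}"
  morphisms toks Abs_D
  using ideal_empty by blast

setup_lifting type_definition_D

lemma ideal_toks [simp]: "ideal (toks d)"
  using toks by simp

lemma toks_Abs [simp]: "ideal u \<Longrightarrow> toks (Abs_D u) = u"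
  by (simp add: Abs_D_inverse)

lemma D_eqI: "(\<And>t. t \<in> toks d \<longleftrightarrow> t \<in> toks e) \<Longrightarrow> d = e"
  by (metis subsetI subset_antisym toks_inject)

lemma toks_wf: "t \<in> toks d \<Longrightarrow> wf_tok t"
  using ideal_toks[of d] by (auto simp: ideal_def)

lemma toks_coh: "s \<in> toks d \<Longrightarrow> t \<in> toks d \<Longrightarrow> coh s t"
  using ideal_toks[of d] by (auto simp: ideal_def)

lemma toks_closed: "toks d \<turnstile> t \<Longrightarrow> wf_tok t \<Longrightarrow> t \<in> toks d"
  using ideal_toks[of d] by (auto simp: ideal_def)

lemma ideal_directed_Union:
  assumes "\<And>u. u \<in> A \<Longrightarrow> ideal u" "\<And>u v. u \<in> A \<Longrightarrow> v \<in> A \<Longrightarrow> \<exists>w\<in>A. u \<union> v \<subseteq> w"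
  shows "ideal (\<Union>A)"
proof -
  have fin: "\<exists>w\<in>A. F \<subseteq> w" if "finite F" "F \<noteq> {}" "F \<subseteq> \<Union>A" for F
    using that
  proof (induction F rule: finite_ne_induct)
    case (insert x F)
    then obtain w u where "w \<in> A" "F \<subseteq> w" "u \<in> A" "x \<in> u" by auto
    moreover obtain v where "v \<in> A" "w \<union> u \<subseteq> v" using assms(2)[OF \<open>w \<in> A\<close> \<open>u \<in> A\<close>] by blast
    ultimately show ?case by auto
  qed auto
  have "coh s t" if "s \<in> \<Union>A" "t \<in> \<Union>A" for s t
  proof -
    have "\<exists>w\<in>A. {s, t} \<subseteq> w" by (rule fin) (use that in auto)
    then obtain w where "w \<in> A" "{s, t} \<subseteq> w" by blast
    then show ?thesis using assms(1)[of w] by (auto simp: ideal_def)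
  qed
  moreover have "t \<in> \<Union>A" if wf: "wf_tok t" and ent: "\<Union>A \<turnstile> t" for t
  proof -
    obtain F where F: "finite F" "F \<subseteq> \<Union>A" "F \<turnstile> t" using entails_compact[OF ent] by blast
    then have "F \<noteq> {}" by auto
    then obtain w where "w \<in> A" "F \<subseteq> w" using fin F by blast
    then have "w \<turnstile> t" using entails_mono[OF F(3)] by simp
    then show ?thesis using assms(1)[OF \<open>w \<in> A\<close>] \<open>w \<in> A\<close> wf by (auto simp: ideal_def)
  qed
  moreover have "\<forall>t\<in>\<Union>A. wf_tok t" using assms(1) by (auto simp: ideal_def)
  ultimately show ?thesis unfolding ideal_def by simp
qed

instantiation D :: "{order_bot, ccpo}"
begin

lift_definition less_eq_D :: "D \<Rightarrow> D \<Rightarrow> bool" is "(\<subseteq>)" .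

definition less_D :: "D \<Rightarrow> D \<Rightarrow> bool" where
  "less_D d e \<longleftrightarrow> d \<le> e \<and> \<not> e \<le> d"

definition bot_D :: D where
  "bot_D = Abs_D {}"

text \<open>The union is an ideal, and hence the supremum, for chains only (\<open>ideal_chain_Union\<close>).\<close>

definition Sup_D :: "D set \<Rightarrow> D" where
  "Sup_D A = Abs_D (\<Union> (toks ` A))"

lemma ideal_chain_Union:
  assumes "Complete_Partial_Order.chain (\<le>) (A :: D set)"
  shows "ideal (\<Union> (toks ` A))"
proof (rule ideal_directed_Union)
  fix u v assume "u \<in> toks ` A" "v \<in> toks ` A"
  then obtain d e where "d \<in> A" "e \<in> A" "u = toks d" "v = toks e" by blast
  then show "\<exists>w\<in>toks ` A. u \<union> v \<subseteq> w"
    using chainD[OF assms, of d e] by (auto simp: less_eq_D.rep_eq)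
qed auto

instance
proof
  fix A :: "D set" and d :: D
  assume A: "Complete_Partial_Order.chain (\<le>) A"
  show "d \<in> A \<Longrightarrow> d \<le> Sup A"
    by (auto simp: Sup_D_def less_eq_D.rep_eq ideal_chain_Union[OF A])
  show "(\<And>e. e \<in> A \<Longrightarrow> e \<le> d) \<Longrightarrow> Sup A \<le> d"
    by (auto simp: Sup_D_def less_eq_D.rep_eq ideal_chain_Union[OF A])
qed (auto simp: less_D_def less_eq_D.rep_eq bot_D_def ideal_empty intro: D_eqI)

end

lemma toks_Sup:
  "Complete_Partial_Order.chain (\<le>) A \<Longrightarrow> toks (Sup A) = \<Union> (toks ` A)"
  by (simp add: Sup_D_def ideal_chain_Union)

lemma toks_bot [simp]: "toks \<bottom> = {}"
  by (simp add: bot_D_def ideal_empty)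

lemma D_leI: "(\<And>t. t \<in> toks d \<Longrightarrow> t \<in> toks e) \<Longrightarrow> d \<le> e"
  by (auto simp: less_eq_D.rep_eq)

lemma D_leD: "d \<le> e \<Longrightarrow> t \<in> toks d \<Longrightarrow> t \<in> toks e"
  by (auto simp: less_eq_D.rep_eq)

lemma D_bounded_complete:
  assumes "\<And>d. d \<in> A \<Longrightarrow> d \<le> (b :: D)"
  shows "\<exists>s. (\<forall>d\<in>A. d \<le> s) \<and> (\<forall>c. (\<forall>d\<in>A. d \<le> c) \<longrightarrow> s \<le> c)"
proof -
  let ?U = "\<Union> (toks ` A)"
  have "?U \<subseteq> toks b" using assms by (auto dest: D_leD)
  then have U: "consis ?U" by (rule ideal_consis[OF ideal_toks])
  have "clos ?U \<subseteq> toks c" if "\<forall>d\<in>A. d \<le> c" for c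
    by (rule clos_least) (use that in \<open>auto dest: D_leD\<close>)
  then show ?thesis
    using clos_incl[OF U]
    by (intro exI[of _ "Abs_D (clos ?U)"]) (auto simp: less_eq_D.rep_eq ideal_clos[OF U])
qed

definition el :: "tok list \<Rightarrow> D" where
  "el xs = Abs_D (clos (set xs))"

lemma toks_el: "consis (set xs) \<Longrightarrow> toks (el xs) = clos (set xs)"
  by (simp add: el_def ideal_clos)

lemma el_le_iff: "consis (set xs) \<Longrightarrow> el xs \<le> d \<longleftrightarrow> set xs \<subseteq> toks d"
  using clos_least[OF ideal_toks, of "set xs" d] clos_incl[of "set xs"]
  by (auto simp: less_eq_D.rep_eq toks_el)

lemma consis_toks: "X \<subseteq> toks d \<Longrightarrow> consis X"
  by (rule ideal_consis[OF ideal_toks])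

lemma el_le: "set xs \<subseteq> toks d \<Longrightarrow> el xs \<le> d"
  using el_le_iff consis_toks by blast

lemma chain_range_nat: "mono (f :: nat \<Rightarrow> D) \<Longrightarrow> Complete_Partial_Order.chain (\<le>) (range f)"
  unfolding chain_def by (metis monoD nat_le_linear rangeE)

lemma finite_subset_chain:
  assumes "Complete_Partial_Order.chain (\<le>) A" "finite F" "F \<subseteq> \<Union> (toks ` A)" "A \<noteq> {}"
  shows "\<exists>d\<in>A. F \<subseteq> toks d"
  using assms(2,3)
proof (induction F rule: finite_induct)
  case (insert x F)
  then obtain d e where "d \<in> A" "F \<subseteq> toks d" "e \<in> A" "x \<in> toks e" by auto
  then show ?case using chainD[OF assms(1), of d e] by (auto simp: less_eq_D.rep_eq)
qed (use assms in auto)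

lemma el_compact:
  assumes "consis (set xs)" "Complete_Partial_Order.chain (\<le>) A" "A \<noteq> {}" "el xs \<le> Sup A"
  shows "\<exists>d\<in>A. el xs \<le> d"
proof -
  have "set xs \<subseteq> \<Union> (toks ` A)"
    using assms(4) el_le_iff[OF assms(1)] toks_Sup[OF assms(2)] by simp
  then show ?thesis
    using finite_subset_chain[OF assms(2) _ _ assms(3), of "set xs"] el_le_iff[OF assms(1)] by auto
qed

lemma D_algebraic:
  "\<exists>xss :: nat \<Rightarrow> tok list.
    mono (\<lambda>n. el (xss n)) \<and> (\<forall>n. set (xss n) \<subseteq> toks d) \<and> d = (\<Squnion>n. el (xss n))"
proof -
  define xss where "xss n = filter (\<lambda>t. t \<in> toks d) (map from_nat [0..<n])" for n
  have sub: "set (xss n) \<subseteq> toks d" for n by (auto simp: xss_def)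
  have con: "consis (set (xss n))" for n by (rule consis_toks[OF sub])
  have inc: "mono (\<lambda>n. el (xss n))"
  proof (rule mono_iff_le_Suc[THEN iffD2], rule allI)
    fix n
    have "set (xss n) \<subseteq> set (xss (Suc n))" by (auto simp: xss_def)
    then show "el (xss n) \<le> el (xss (Suc n))"
      using clos_mono by (simp add: less_eq_D.rep_eq toks_el con)
  qed
  have "d = (\<Squnion>n. el (xss n))"
  proof (rule order.antisym)
    show "d \<le> (\<Squnion>n. el (xss n))"
    proof (rule D_leI)
      fix t assume "t \<in> toks d"
      then have "t \<in> set (xss (Suc (to_nat t)))" by (simp add: xss_def)
      then have "t \<in> toks (el (xss (Suc (to_nat t))))"
        using clos_incl[OF con] by (auto simp: toks_el con)
      then show "t \<in> toks (\<Squnion>n. el (xss n))"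
        using toks_Sup[OF chain_range_nat[OF inc]] by auto
    qed
    show "(\<Squnion>n. el (xss n)) \<le> d"
      by (rule ccpo_Sup_least[OF chain_range_nat[OF inc]]) (use sub el_le in auto)
  qed
  with inc sub show ?thesis by blast
qed

text \<open>
  Continuity is preservation of suprema of nonempty chains, \<^term>\<open>mcont Sup (\<le>) Sup (\<le>)\<close>;
  this is equivalent to Scott continuity, see \<open>cont_iff_finitary\<close>.
\<close>

abbreviation scott_cont :: "(D \<Rightarrow> D) \<Rightarrow> bool" where
  "scott_cont \<equiv> mcont Sup (\<le>) Sup (\<le>)"

lemma cont_iff_finitary:
  "scott_cont f \<longleftrightarrow>
    (\<forall>d e. d \<le> e \<longrightarrow> f d \<le> f e) \<and>
    (\<forall>d. \<forall>t\<in>toks (f d). \<exists>xs. set xs \<subseteq> toks d \<and> t \<in> toks (f (el xs)))"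
proof (intro iffI conjI allI impI ballI)
  assume f: "scott_cont f"
  show mono: "f d \<le> f e" if "d \<le> e" for d e
    using mcont_monoD[OF f that] .
  fix d t assume t: "t \<in> toks (f d)"
  from D_algebraic[of d] obtain xss :: "nat \<Rightarrow> tok list"
    where xss: "mono (\<lambda>n. el (xss n)) \<and> (\<forall>n. set (xss n) \<subseteq> toks d) \<and> d = (\<Squnion>n. el (xss n))" ..
  note inc = conjunct1[OF xss] and sub = conjunct1[OF conjunct2[OF xss]]
  have "f d = f (\<Squnion>n. el (xss n))"
    by (rule arg_cong[where f=f]) (rule conjunct2[OF conjunct2[OF xss]])
  also have "\<dots> = (\<Squnion>n. f (el (xss n)))"
    using mcont_contD[OF f chain_range_nat[OF inc]] by (simp add: image_image)
  finally have "f d = (\<Squnion>n. f (el (xss n)))" .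
  moreover have "mono (\<lambda>n. f (el (xss n)))"
    by (rule monoI) (use monoD[OF inc] mono in blast)
  ultimately have "\<exists>n. t \<in> toks (f (el (xss n)))"
    using t toks_Sup[OF chain_range_nat, of "\<lambda>n. f (el (xss n))"] by auto
  then show "\<exists>xs. set xs \<subseteq> toks d \<and> t \<in> toks (f (el xs))" using sub by blast
next
  assume f': "(\<forall>d e. d \<le> e \<longrightarrow> f d \<le> f e) \<and>
    (\<forall>d. \<forall>t\<in>toks (f d). \<exists>xs. set xs \<subseteq> toks d \<and> t \<in> toks (f (el xs)))"
  then have f: "f d \<le> f e" if "d \<le> e" for d e using that by blast
  have fin: "\<exists>xs. set xs \<subseteq> toks d \<and> t \<in> toks (f (el xs))" if "t \<in> toks (f d)" for d t
    using f' that by blast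
  show "scott_cont f"
  proof (rule mcontI)
    show "monotone (\<le>) (\<le>) f" using f by (rule monotoneI)
    show "cont Sup (\<le>) Sup (\<le>) f"
    proof (rule contI)
      fix Y :: "D set" assume Y: "Complete_Partial_Order.chain (\<le>) Y" "Y \<noteq> {}"
      have fY: "Complete_Partial_Order.chain (\<le>) (f ` Y)"
        by (rule chain_imageI[OF Y(1)], rule f)
      show "f (Sup Y) = Sup (f ` Y)"
      proof (rule order.antisym)
        show "Sup (f ` Y) \<le> f (Sup Y)"
          by (rule ccpo_Sup_least[OF fY]) (auto intro: f ccpo_Sup_upper[OF Y(1)])
        show "f (Sup Y) \<le> Sup (f ` Y)"
        proof (rule D_leI)
          fix t assume "t \<in> toks (f (Sup Y))"
          then obtain xs where xs: "set xs \<subseteq> toks (Sup Y)" "t \<in> toks (f (el xs))" using fin by blast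
          then obtain d where "d \<in> Y" "set xs \<subseteq> toks d"
            using finite_subset_chain[OF Y(1) _ _ Y(2), of "set xs"] by (auto simp: toks_Sup[OF Y(1)])
          then have "t \<in> toks (f d)" using D_leD[OF f[OF el_le]] xs(2) by simp
          then show "t \<in> toks (Sup (f ` Y))" using \<open>d \<in> Y\<close> by (auto simp: toks_Sup[OF fY])
        qed
      qed
    qed
  qed
qed

lemma cont_monoD: "scott_cont f \<Longrightarrow> d \<le> e \<Longrightarrow> f d \<le> f e"
  by (rule mcont_monoD)

lemma cont_finitaryD:
  "scott_cont f \<Longrightarrow> t \<in> toks (f d) \<Longrightarrow> \<exists>xs. set xs \<subseteq> toks d \<and> t \<in> toks (f (el xs))"
  by (rule cont_iff_finitary[THEN iffD1, THEN conjunct2, THEN spec, THEN bspec])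

typedef cfun = "{f :: D \<Rightarrow> D. scott_cont f}"
  morphisms app Cfun
  by (rule exI[of _ "\<lambda>d. d"]) simp

notation app (infixl "\<bullet>" 900)

lemma cont_app [simp]: "scott_cont (app f)"
  using app by simp

lemma app_Cfun [simp]: "scott_cont f \<Longrightarrow> Cfun f \<bullet> d = f d"
  by (simp add: Cfun_inverse)

lemma cfun_eqI: "(\<And>d. f \<bullet> d = g \<bullet> d) \<Longrightarrow> f = g"
  by (metis app_inject ext)

lemma app_mono: "d \<le> e \<Longrightarrow> f \<bullet> d \<le> f \<bullet> e"
  by (rule cont_monoD) simp_all

definition con_toks :: "tag \<Rightarrow> D list \<Rightarrow> tok set" where
  "con_toks c ds = insert (Tag c) {Arg c i t | i t. i < length ds \<and> t \<in> toks (ds ! i)}"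

definition fun_toks :: "cfun \<Rightarrow> tok set" where
  "fun_toks f =
    insert (Tag FunT) {Step xs t | xs t. consis (set xs) \<and> t \<in> toks (f \<bullet> el xs)}"

definition DNil :: D where "DNil = Abs_D (con_toks NilT [])"
definition DLeft :: "D \<Rightarrow> D" where "DLeft d = Abs_D (con_toks LeftT [d])"
definition DRight :: "D \<Rightarrow> D" where "DRight d = Abs_D (con_toks RightT [d])"
definition DPair :: "D \<Rightarrow> D \<Rightarrow> D" where "DPair d e = Abs_D (con_toks PairT [d, e])"
definition DAmb :: "D \<Rightarrow> D \<Rightarrow> D" where "DAmb d e = Abs_D (con_toks AmbT [d, e])"
definition DFun :: "cfun \<Rightarrow> D" where "DFun f = Abs_D (fun_toks f)"

lemma ideal_con_toks:
  assumes "length ds = arity c" "c \<noteq> FunT"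
  shows "ideal (con_toks c ds)"
proof -
  have "t \<in> con_toks c ds" if t: "wf_tok t" "con_toks c ds \<turnstile> t" for t
  proof -
    have tag: "tag_of t = c" using entails_tag_of[OF t(2)] by (auto simp: con_toks_def)
    show ?thesis
    proof (cases t)
      case (Tag c')
      then show ?thesis using tag by (simp add: con_toks_def)
    next
      case (Arg c' i s)
      then have c': "c' = c" and i: "i < arity c" "wf_tok s" using tag t by auto
      have "{s. Arg c i s \<in> con_toks c ds} \<turnstile> s" using t(2) Arg c' by (auto elim: entails_ArgE)
      moreover have "{s. Arg c i s \<in> con_toks c ds} = toks (ds ! i)"
        using i assms by (auto simp: con_toks_def)
      ultimately have "s \<in> toks (ds ! i)" using i toks_closed by simp
      then show ?thesis using i assms Arg c' by (auto simp: con_toks_def)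
    next
      case (Step xs s)
      then show ?thesis using tag assms by simp
    qed
  qed
  then show ?thesis
    using assms toks_wf toks_coh by (auto simp: ideal_def con_toks_def)
qed

lemma consis_coh_Un:
  "consis X \<Longrightarrow> consis Y \<Longrightarrow> (\<forall>x\<in>X. \<forall>y\<in>Y. coh x y) \<Longrightarrow> consis (X \<union> Y)"
  using coh_sym unfolding consis_def by (metis UnE)

lemma ideal_fun_toks: "ideal (fun_toks f)"
proof -
  have coh: "coh s t" if c: "consis (set xs)" "consis (set ys)"
    and st: "s \<in> toks (f \<bullet> el xs)" "t \<in> toks (f \<bullet> el ys)"
    and xy: "\<forall>x\<in>set xs. \<forall>y\<in>set ys. coh x y" for xs ys s t
  proof -
    have c2: "consis (set (xs @ ys))" using consis_coh_Un c xy by simp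
    have "el xs \<le> el (xs @ ys)" "el ys \<le> el (xs @ ys)"
      using c c2 clos_mono[of "set xs" "set (xs @ ys)"] clos_mono[of "set ys" "set (xs @ ys)"]
      by (simp_all add: less_eq_D.rep_eq toks_el)
    then have "s \<in> toks (f \<bullet> el (xs @ ys))" "t \<in> toks (f \<bullet> el (xs @ ys))"
      using st app_mono D_leD by blast+
    then show ?thesis by (rule toks_coh)
  qed
  have closed: "t \<in> fun_toks f" if t: "wf_tok t" "fun_toks f \<turnstile> t" for t
  proof -
    have tag: "tag_of t = FunT" using entails_tag_of[OF t(2)] by (auto simp: fun_toks_def)
    show ?thesis
    proof (cases t)
      case (Tag c')
      then show ?thesis using tag by (simp add: fun_toks_def)
    next
      case (Arg c' i s)
      then show ?thesis using tag t by simp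
    next
      case (Step xs s)
      then have c: "consis (set xs)" "wf_tok s" using t wf_Step_iff by auto
      obtain Y where Y: "Y \<turnstile> s"
        "\<And>y. y \<in> Y \<Longrightarrow> \<exists>zs. Step zs y \<in> fun_toks f \<and> (\<forall>z\<in>set zs. set xs \<turnstile> z)"
        using t(2) Step by (auto elim: entails_StepE)
      have "Y \<subseteq> toks (f \<bullet> el xs)"
      proof
        fix y assume "y \<in> Y"
        then obtain zs where zs: "consis (set zs)" "y \<in> toks (f \<bullet> el zs)" "\<forall>z\<in>set zs. set xs \<turnstile> z"
          using Y(2)[of y] by (auto simp: fun_toks_def)
        then have "el zs \<le> el xs"
          using c by (auto simp: el_le_iff toks_el clos_def consis_def)
        then show "y \<in> toks (f \<bullet> el xs)" using zs app_mono D_leD by blast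
      qed
      then have "s \<in> toks (f \<bullet> el xs)" using Y(1) c toks_closed entails_mono by blast
      then show ?thesis using Step c by (simp add: fun_toks_def)
    qed
  qed
  have "\<forall>t\<in>fun_toks f. wf_tok t"
    using toks_wf by (auto simp: fun_toks_def consis_def)
  moreover have "\<forall>s\<in>fun_toks f. \<forall>t\<in>fun_toks f. coh s t"
    using coh by (auto simp: fun_toks_def)
  ultimately show ?thesis using closed unfolding ideal_def by blast
qed

lemma toks_D:
  "toks DNil = con_toks NilT []"
  "toks (DLeft d) = con_toks LeftT [d]"
  "toks (DRight d) = con_toks RightT [d]"
  "toks (DPair d e) = con_toks PairT [d, e]"
  "toks (DAmb d e) = con_toks AmbT [d, e]"
  "toks (DFun f) = fun_toks f"
  unfolding DNil_def DLeft_def DRight_def DPair_def DAmb_def DFun_def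
  by (simp_all add: ideal_con_toks ideal_fun_toks)

lemma Tag_mem_D:
  "Tag c \<notin> toks \<bottom>"
  "Tag c \<in> toks DNil \<longleftrightarrow> c = NilT"
  "Tag c \<in> toks (DLeft d) \<longleftrightarrow> c = LeftT"
  "Tag c \<in> toks (DRight d) \<longleftrightarrow> c = RightT"
  "Tag c \<in> toks (DPair d e) \<longleftrightarrow> c = PairT"
  "Tag c \<in> toks (DAmb d e) \<longleftrightarrow> c = AmbT"
  "Tag c \<in> toks (DFun f) \<longleftrightarrow> c = FunT"
  by (auto simp: toks_D con_toks_def fun_toks_def)

lemma con_toks_subset_iff:
  "con_toks c ds \<subseteq> con_toks c es \<longleftrightarrow>
    (\<forall>i<length ds. \<forall>t\<in>toks (ds ! i). i < length es \<and> t \<in> toks (es ! i))"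
  by (auto simp: con_toks_def)

lemma DLeft_le_iff: "DLeft d \<le> DLeft e \<longleftrightarrow> d \<le> e"
  and DRight_le_iff: "DRight d \<le> DRight e \<longleftrightarrow> d \<le> e"
  and DPair_le_iff: "DPair d d' \<le> DPair e e' \<longleftrightarrow> d \<le> e \<and> d' \<le> e'"
  and DAmb_le_iff: "DAmb d d' \<le> DAmb e e' \<longleftrightarrow> d \<le> e \<and> d' \<le> e'"
  by (auto simp: less_eq_D.rep_eq toks_D con_toks_subset_iff less_Suc_eq)

lemma DFun_le_iff: "DFun f \<le> DFun g \<longleftrightarrow> (\<forall>d. f \<bullet> d \<le> g \<bullet> d)"
proof
  assume le: "DFun f \<le> DFun g"
  show "\<forall>d. f \<bullet> d \<le> g \<bullet> d"
  proof (intro allI D_leI)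
    fix d t assume "t \<in> toks (f \<bullet> d)"
    then obtain xs where xs: "set xs \<subseteq> toks d" "t \<in> toks (f \<bullet> el xs)"
      using cont_finitaryD[OF cont_app] by blast
    then have "Step xs t \<in> toks (DFun g)"
      using consis_toks le by (intro D_leD[OF le]) (auto simp: toks_D fun_toks_def)
    then have "t \<in> toks (g \<bullet> el xs)" by (auto simp: toks_D fun_toks_def)
    then show "t \<in> toks (g \<bullet> d)" using app_mono el_le[OF xs(1)] D_leD by blast
  qed
next
  assume "\<forall>d. f \<bullet> d \<le> g \<bullet> d"
  then show "DFun f \<le> DFun g"
    using D_leD by (auto simp: less_eq_D.rep_eq toks_D fun_toks_def)
qed

definition argD :: "tag \<Rightarrow> nat \<Rightarrow> D \<Rightarrow> D" where
  "argD c i d = Abs_D {t. Arg c i t \<in> toks d}"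

lemma toks_argD: "toks (argD c i d) = {t. Arg c i t \<in> toks d}"
proof -
  have "ideal {t. Arg c i t \<in> toks d}"
    unfolding ideal_def
  proof (intro conjI ballI allI impI)
    fix t assume t: "wf_tok t" "{t. Arg c i t \<in> toks d} \<turnstile> t"
    then obtain s where "Arg c i s \<in> toks d" using entails_tag_of by blast
    then have "i < arity c" using toks_wf by fastforce
    then show "t \<in> {t. Arg c i t \<in> toks d}"
      using t toks_closed[of d "Arg c i t"] entails.Arg by auto
  next
    fix s t assume "s \<in> {t. Arg c i t \<in> toks d}" "t \<in> {t. Arg c i t \<in> toks d}"
    then show "coh s t" using toks_coh[of "Arg c i s" d "Arg c i t"] by simp
  qed (use toks_wf in fastforce)
  then show ?thesis by (simp add: argD_def)
qed

lemma Tag_memI: "t \<in> toks d \<Longrightarrow> Tag (tag_of t) \<in> toks d"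
  using toks_closed[of d] entails.Tag by auto

lemma tag_of_mem: "Tag c \<in> toks d \<Longrightarrow> t \<in> toks d \<Longrightarrow> tag_of t = c"
  using toks_coh[of "Tag c" d t] coh_tag_of by fastforce

lemma toks_eq_con_toks:
  assumes "Tag c \<in> toks d" "c \<noteq> FunT"
  shows "toks d = con_toks c (map (\<lambda>i. argD c i d) [0..<arity c])"
proof (intro equalityI subsetI)
  fix t assume t: "t \<in> toks d"
  show "t \<in> con_toks c (map (\<lambda>i. argD c i d) [0..<arity c])"
    using tag_of_mem[OF assms(1) t] toks_wf[OF t] t assms
    by (cases t) (auto simp: con_toks_def toks_argD)
next
  fix t assume "t \<in> con_toks c (map (\<lambda>i. argD c i d) [0..<arity c])"
  then show "t \<in> toks d" using assms by (auto simp: con_toks_def toks_argD)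
qed

definition fun_of :: "D \<Rightarrow> D \<Rightarrow> D" where
  "fun_of u d = Abs_D {t. \<exists>xs. Step xs t \<in> toks u \<and> set xs \<subseteq> toks d}"

lemma toks_fun_of: "toks (fun_of u d) = {t. \<exists>xs. Step xs t \<in> toks u \<and> set xs \<subseteq> toks d}"
proof -
  let ?U = "{t. \<exists>xs. Step xs t \<in> toks u \<and> set xs \<subseteq> toks d}"
  have "ideal ?U"
    unfolding ideal_def
  proof (intro conjI ballI allI impI)
    fix t assume t: "wf_tok t" "?U \<turnstile> t"
    obtain F where F: "finite F" "F \<subseteq> ?U" "F \<turnstile> t" using entails_compact[OF t(2)] by blast
    then have "\<forall>y\<in>F. \<exists>xs. Step xs y \<in> toks u \<and> set xs \<subseteq> toks d" by blast
    then obtain g where g: "\<And>y. y \<in> F \<Longrightarrow> Step (g y) y \<in> toks u \<and> set (g y) \<subseteq> toks d" by metis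
    obtain ys where ys: "set ys = F" using F finite_list by blast
    define xs where "xs = concat (map g ys)"
    have sub: "set xs \<subseteq> toks d" using g ys by (auto simp: xs_def)
    have "toks u \<turnstile> Step xs t"
    proof (rule entails.Step[OF F(3)])
      fix y assume "y \<in> F"
      then have "Step (g y) y \<in> toks u" "set (g y) \<subseteq> set xs" using g ys by (auto simp: xs_def)
      then show "\<exists>zs. Step zs y \<in> toks u \<and> (\<forall>z\<in>set zs. set xs \<turnstile> z)"
        using entails_refl by blast
    qed
    moreover have "wf_tok (Step xs t)" using t consis_toks[OF sub] wf_Step_iff by blast
    ultimately have "Step xs t \<in> toks u" by (rule toks_closed)
    then show "t \<in> ?U" using sub by blast
  next
    fix s t assume "s \<in> ?U" "t \<in> ?U"
    then obtain xs ys where "Step xs s \<in> toks u" "set xs \<subseteq> toks d" "Step ys t \<in> toks u" "set ys \<subseteq> toks d"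
      by blast
    moreover from this have "\<forall>x\<in>set xs. \<forall>y\<in>set ys. coh x y" using toks_coh by blast
    ultimately show "coh s t" using toks_coh[of "Step xs s" u "Step ys t"] by simp
  next
    fix t assume "t \<in> ?U"
    then show "wf_tok t" using toks_wf by fastforce
  qed
  then show ?thesis by (simp add: fun_of_def)
qed

lemma cont_fun_of: "scott_cont (fun_of u)"
proof -
  have "set xs \<subseteq> toks d \<Longrightarrow> set xs \<subseteq> toks (el xs)" for xs d
    using consis_toks clos_incl toks_el by blast
  then show ?thesis
    unfolding cont_iff_finitary by (simp add: toks_fun_of less_eq_D.rep_eq) blast
qed

lemma DFun_fun_of:
  assumes "Tag FunT \<in> toks u"
  shows "u = DFun (Cfun (fun_of u))"
proof -
  have "Step xs t \<in> toks u \<longleftrightarrow> consis (set xs) \<and> t \<in> toks (fun_of u (el xs))" for xs t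
  proof safe
    assume t: "Step xs t \<in> toks u"
    show c: "consis (set xs)" using toks_wf[OF t] wf_Step_iff by blast
    show "t \<in> toks (fun_of u (el xs))"
      using t clos_incl[OF c] by (auto simp: toks_fun_of toks_el[OF c])
  next
    assume c: "consis (set xs)" and "t \<in> toks (fun_of u (el xs))"
    then obtain ys where ys: "Step ys t \<in> toks u" "set ys \<subseteq> clos (set xs)"
      by (auto simp: toks_fun_of toks_el)
    have "toks u \<turnstile> Step xs t"
      by (rule entails.Step[where Y="{t}"]) (use ys entails_refl in \<open>auto simp: clos_def\<close>)
    moreover have "wf_tok (Step xs t)" using c toks_wf[OF ys(1)] wf_Step_iff by blast
    ultimately show "Step xs t \<in> toks u" by (rule toks_closed)
  qed
  moreover have "t \<in> toks u \<Longrightarrow> t = Tag FunT \<or> (\<exists>xs s. t = Step xs s)" for t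
    using tag_of_mem[OF assms, of t] toks_wf[of t u] by (cases t) auto
  ultimately have "t \<in> toks u \<longleftrightarrow> t \<in> fun_toks (Cfun (fun_of u))" for t
    using assms by (cases t) (auto simp: fun_toks_def cont_fun_of)
  then have "toks u = fun_toks (Cfun (fun_of u))" by blast
  then show ?thesis by (simp add: toks_D flip: toks_inject)
qed

lemma D_injects:
  "DLeft d = DLeft e \<longleftrightarrow> d = e"
  "DRight d = DRight e \<longleftrightarrow> d = e"
  "DPair d d' = DPair e e' \<longleftrightarrow> d = e \<and> d' = e'"
  "DAmb d d' = DAmb e e' \<longleftrightarrow> d = e \<and> d' = e'"
  "DFun f = DFun g \<longleftrightarrow> f = g"
  by (auto simp: order.eq_iff DLeft_le_iff DRight_le_iff DPair_le_iff DAmb_le_iff DFun_le_iff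
      intro!: cfun_eqI)

text \<open>
  Every element of \<open>D\<close> is uniquely bottom or in the image of exactly one of the injections; the order
  on the summands is described by \<open>D_le_iff\<close>.
\<close>

free_constructors case_D for
    "\<bottom> :: D"
  | DNil
  | DLeft
  | DRight
  | DPair
  | DAmb
  | DFun
proof -
  fix P and d :: D
  assume cases: "d = \<bottom> \<Longrightarrow> P" "d = DNil \<Longrightarrow> P" "\<And>e. d = DLeft e \<Longrightarrow> P" "\<And>e. d = DRight e \<Longrightarrow> P"
    "\<And>e e'. d = DPair e e' \<Longrightarrow> P" "\<And>e e'. d = DAmb e e' \<Longrightarrow> P" "\<And>f. d = DFun f \<Longrightarrow> P"
  show P
  proof (cases "d = \<bottom>")
    case False
    then obtain t where "t \<in> toks d" using D_eqI[of d \<bottom>] by auto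
    then have tag: "Tag (tag_of t) \<in> toks d" by (rule Tag_memI)
    show P
    proof (cases "tag_of t")
      case NilT
      then have "toks d = toks DNil"
        using toks_eq_con_toks[OF tag] by (simp add: toks_D)
      then show P using cases(2) toks_inject by blast
    next
      case LeftT
      then have "toks d = toks (DLeft (argD LeftT 0 d))"
        using toks_eq_con_toks[OF tag] by (simp add: toks_D)
      then show P using cases(3) toks_inject by blast
    next
      case RightT
      then have "toks d = toks (DRight (argD RightT 0 d))"
        using toks_eq_con_toks[OF tag] by (simp add: toks_D)
      then show P using cases(4) toks_inject by blast
    next
      case PairT
      then have "toks d = toks (DPair (argD PairT 0 d) (argD PairT 1 d))"
        using toks_eq_con_toks[OF tag] by (simp add: toks_D upt_conv_Cons)
      then show P using cases(5) toks_inject by blast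
    next
      case AmbT
      then have "toks d = toks (DAmb (argD AmbT 0 d) (argD AmbT 1 d))"
        using toks_eq_con_toks[OF tag] by (simp add: toks_D upt_conv_Cons)
      then show P using cases(6) toks_inject by blast
    next
      case FunT
      then show P using cases(7) DFun_fun_of tag by metis
    qed
  qed (rule cases(1))
qed (simp_all only: D_injects, (rule notI, drule arg_cong[where f="\<lambda>d. {c. Tag c \<in> toks d}"],
      simp add: Tag_mem_D)+)

lemma D_le_iff:
  "d \<le> e \<longleftrightarrow>
    (case d of
      \<bottom> \<Rightarrow> True
    | DNil \<Rightarrow> e = DNil
    | DLeft a \<Rightarrow> (\<exists>b. e = DLeft b \<and> a \<le> b)
    | DRight a \<Rightarrow> (\<exists>b. e = DRight b \<and> a \<le> b)
    | DPair a a' \<Rightarrow> (\<exists>b b'. e = DPair b b' \<and> a \<le> b \<and> a' \<le> b')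
    | DAmb a a' \<Rightarrow> (\<exists>b b'. e = DAmb b b' \<and> a \<le> b \<and> a' \<le> b')
    | DFun f \<Rightarrow> (\<exists>g. e = DFun g \<and> (\<forall>x. f \<bullet> x \<le> g \<bullet> x)))"
proof -
  have "d \<le> e \<Longrightarrow> Tag c \<in> toks d \<Longrightarrow> Tag c \<in> toks e" for c by (rule D_leD)
  then show ?thesis
    by (cases d; cases e)
      (auto simp: Tag_mem_D DLeft_le_iff DRight_le_iff DPair_le_iff DAmb_le_iff DFun_le_iff)
qed

lemma scott_contI:
  assumes "\<And>d e. d \<le> e \<Longrightarrow> f d \<le> f e"
    and "\<And>d t. t \<in> toks (f d) \<Longrightarrow> \<exists>xs. set xs \<subseteq> toks d \<and> t \<in> toks (f (el xs))"
  shows "scott_cont f"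
  unfolding cont_iff_finitary by (intro conjI allI impI ballI assms)

lemma cont_const: "scott_cont (\<lambda>d. c)"
  by (rule scott_contI) (auto intro: exI[of _ "[]"])

lemma cont_comp:
  assumes f: "scott_cont f" and g: "scott_cont g"
  shows "scott_cont (\<lambda>d. f (g d))"
proof (rule scott_contI)
  show "f (g d) \<le> f (g e)" if "d \<le> e" for d e
    by (rule cont_monoD[OF f cont_monoD[OF g that]])
next
  fix d t assume "t \<in> toks (f (g d))"
  then obtain ys where ys: "set ys \<subseteq> toks (g d)" "t \<in> toks (f (el ys))"
    using cont_finitaryD[OF f, of t "g d"] by blast
  have "\<forall>y\<in>set ys. \<exists>xs. set xs \<subseteq> toks d \<and> y \<in> toks (g (el xs))"
    by (intro ballI cont_finitaryD[OF g]) (use ys in blast)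
  then obtain k where k: "\<And>y. y \<in> set ys \<Longrightarrow> set (k y) \<subseteq> toks d \<and> y \<in> toks (g (el (k y)))"
    by metis
  define xs where "xs = concat (map k ys)"
  have xs: "set xs \<subseteq> toks d" using k by (auto simp: xs_def)
  have "set ys \<subseteq> toks (g (el xs))"
  proof
    fix y assume y: "y \<in> set ys"
    have "set (k y) \<subseteq> set xs" using y by (auto simp: xs_def)
    also have "\<dots> \<subseteq> toks (el xs)"
      using clos_incl[OF consis_toks[OF xs]] toks_el[OF consis_toks[OF xs]] by simp
    finally have "set (k y) \<subseteq> toks (el xs)" .
    then show "y \<in> toks (g (el xs))" using k[OF y] D_leD[OF cont_monoD[OF g el_le]] by simp
  qed
  then have "t \<in> toks (f (g (el xs)))" using D_leD[OF cont_monoD[OF f el_le]] ys(2) by simp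
  then show "\<exists>xs. set xs \<subseteq> toks d \<and> t \<in> toks (f (g (el xs)))" using xs by blast
qed

text \<open>
  Among all solutions of the domain equation \<open>D\<close> is the minimal one: the identity is the least
  continuous function that commutes with the injections.
\<close>

lemma D_minimal:
  assumes h: "scott_cont h"
    and h_eqs: "h DNil = DNil" "\<And>d. h (DLeft d) = DLeft (h d)" "\<And>d. h (DRight d) = DRight (h d)"
      "\<And>d e. h (DPair d e) = DPair (h d) (h e)" "\<And>d e. h (DAmb d e) = DAmb (h d) (h e)"
      "\<And>f. h (DFun f) = DFun (Cfun (\<lambda>d. h (f \<bullet> h d)))"
  shows "d \<le> h d"
proof -
  have "t \<in> toks d \<Longrightarrow> t \<in> toks (h d)" for t
  proof (induction t arbitrary: d)
    case (Tag c)
    then show ?case by (cases d) (auto simp: Tag_mem_D h_eqs)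
  next
    case (Arg c i t)
    then show ?case
      by (cases d) (auto simp: h_eqs toks_D con_toks_def fun_toks_def less_Suc_eq)
  next
    case (Step xs t)
    then obtain f where d: "d = DFun f" and xs: "consis (set xs)" and t: "t \<in> toks (f \<bullet> el xs)"
      by (cases d) (auto simp: toks_D con_toks_def fun_toks_def)
    have "set xs \<subseteq> toks (h (el xs))"
      using Step.IH(1) clos_incl[OF xs] by (auto simp: toks_el[OF xs])
    then have "t \<in> toks (f \<bullet> h (el xs))" using D_leD[OF app_mono[OF el_le]] t by simp
    then have "t \<in> toks (h (f \<bullet> h (el xs)))" by (rule Step.IH(2))
    moreover have "scott_cont (\<lambda>d. h (f \<bullet> h d))"
      by (rule cont_comp[OF h cont_comp[OF cont_app h]])
    ultimately show ?case using xs by (simp add: d h_eqs toks_D fun_toks_def)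
  qed
  then show ?thesis by (rule D_leI)
qed

section \<open>Programs\<close>

text \<open>
  Programs up to renaming of bound variables, with de Bruijn indices.  \<open>Lam M\<close> and the branches of
  \<open>CaseLR\<close> bind index 0; in \<open>CasePair M N\<close> and \<open>CaseAmb M N\<close> the clause body \<open>N\<close> has two bound
  variables, index 0 for the first and index 1 for the second component.
  \<open>SApp M N\<close> is the strict application \<open>M \<down> N\<close>.
\<close>

datatype prog =
    Var nat
  | Lam prog
  | App prog prog
  | SApp prog prog
  | Rec prog
  | Bot
  | NilP
  | LeftP prog
  | RightP prog
  | PairP prog prog
  | AmbP prog prog
  | CaseLR prog prog prog
  | CasePair prog prog
  | CaseAmb prog prog

primrec fv :: "prog \<Rightarrow> nat set" where
  "fv (Var n) = {n}"
| "fv (Lam M) = {n. Suc n \<in> fv M}"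
| "fv (App M N) = fv M \<union> fv N"
| "fv (SApp M N) = fv M \<union> fv N"
| "fv (Rec M) = fv M"
| "fv Bot = {}"
| "fv NilP = {}"
| "fv (LeftP M) = fv M"
| "fv (RightP M) = fv M"
| "fv (PairP M N) = fv M \<union> fv N"
| "fv (AmbP M N) = fv M \<union> fv N"
| "fv (CaseLR M L R) = fv M \<union> {n. Suc n \<in> fv L} \<union> {n. Suc n \<in> fv R}"
| "fv (CasePair M N) = fv M \<union> {n. Suc (Suc n) \<in> fv N}"
| "fv (CaseAmb M N) = fv M \<union> {n. Suc (Suc n) \<in> fv N}"

definition closed_prog :: "prog \<Rightarrow> bool" where
  "closed_prog M \<longleftrightarrow> fv M = {}"

definition up_ren :: "(nat \<Rightarrow> nat) \<Rightarrow> nat \<Rightarrow> nat" where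
  "up_ren r = case_nat 0 (\<lambda>n. Suc (r n))"

primrec ren :: "(nat \<Rightarrow> nat) \<Rightarrow> prog \<Rightarrow> prog" where
  "ren r (Var n) = Var (r n)"
| "ren r (Lam M) = Lam (ren (up_ren r) M)"
| "ren r (App M N) = App (ren r M) (ren r N)"
| "ren r (SApp M N) = SApp (ren r M) (ren r N)"
| "ren r (Rec M) = Rec (ren r M)"
| "ren r Bot = Bot"
| "ren r NilP = NilP"
| "ren r (LeftP M) = LeftP (ren r M)"
| "ren r (RightP M) = RightP (ren r M)"
| "ren r (PairP M N) = PairP (ren r M) (ren r N)"
| "ren r (AmbP M N) = AmbP (ren r M) (ren r N)"
| "ren r (CaseLR M L R) = CaseLR (ren r M) (ren (up_ren r) L) (ren (up_ren r) R)"
| "ren r (CasePair M N) = CasePair (ren r M) (ren (up_ren (up_ren r)) N)"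
| "ren r (CaseAmb M N) = CaseAmb (ren r M) (ren (up_ren (up_ren r)) N)"

definition up_subst :: "(nat \<Rightarrow> prog) \<Rightarrow> nat \<Rightarrow> prog" where
  "up_subst s = case_nat (Var 0) (\<lambda>n. ren Suc (s n))"

primrec subst :: "(nat \<Rightarrow> prog) \<Rightarrow> prog \<Rightarrow> prog" where
  "subst s (Var n) = s n"
| "subst s (Lam M) = Lam (subst (up_subst s) M)"
| "subst s (App M N) = App (subst s M) (subst s N)"
| "subst s (SApp M N) = SApp (subst s M) (subst s N)"
| "subst s (Rec M) = Rec (subst s M)"
| "subst s Bot = Bot"
| "subst s NilP = NilP"
| "subst s (LeftP M) = LeftP (subst s M)"
| "subst s (RightP M) = RightP (subst s M)"
| "subst s (PairP M N) = PairP (subst s M) (subst s N)"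
| "subst s (AmbP M N) = AmbP (subst s M) (subst s N)"
| "subst s (CaseLR M L R) = CaseLR (subst s M) (subst (up_subst s) L) (subst (up_subst s) R)"
| "subst s (CasePair M N) = CasePair (subst s M) (subst (up_subst (up_subst s)) N)"
| "subst s (CaseAmb M N) = CaseAmb (subst s M) (subst (up_subst (up_subst s)) N)"

definition subst1 :: "prog \<Rightarrow> prog \<Rightarrow> prog" where
  "subst1 M N = subst (case_nat N Var) M"

definition subst2 :: "prog \<Rightarrow> prog \<Rightarrow> prog \<Rightarrow> prog" where
  "subst2 M N\<^sub>1 N\<^sub>2 = subst (case_nat N\<^sub>1 (case_nat N\<^sub>2 Var)) M"


section \<open>Denotational semantics\<close>

primrec den :: "prog \<Rightarrow> (nat \<Rightarrow> D) \<Rightarrow> D" where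
  "den (Var n) \<eta> = \<eta> n"
| "den (Lam M) \<eta> = DFun (Cfun (\<lambda>d. den M (case_nat d \<eta>)))"
| "den (App M N) \<eta> = (case den M \<eta> of DFun f \<Rightarrow> f \<bullet> den N \<eta> | _ \<Rightarrow> \<bottom>)"
| "den (SApp M N) \<eta> =
    (case den M \<eta> of DFun f \<Rightarrow> if den N \<eta> \<noteq> \<bottom> then f \<bullet> den N \<eta> else \<bottom> | _ \<Rightarrow> \<bottom>)"
| "den (Rec M) \<eta> = (case den M \<eta> of DFun f \<Rightarrow> (LEAST d. f \<bullet> d = d) | _ \<Rightarrow> \<bottom>)"
| "den Bot \<eta> = \<bottom>"
| "den NilP \<eta> = DNil"
| "den (LeftP M) \<eta> = DLeft (den M \<eta>)"
| "den (RightP M) \<eta> = DRight (den M \<eta>)"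
| "den (PairP M N) \<eta> = DPair (den M \<eta>) (den N \<eta>)"
| "den (AmbP M N) \<eta> = DAmb (den M \<eta>) (den N \<eta>)"
| "den (CaseLR M L R) \<eta> =
    (case den M \<eta> of
      DLeft d \<Rightarrow> den L (case_nat d \<eta>)
    | DRight d \<Rightarrow> den R (case_nat d \<eta>)
    | _ \<Rightarrow> \<bottom>)"
| "den (CasePair M N) \<eta> =
    (case den M \<eta> of DPair d e \<Rightarrow> den N (case_nat d (case_nat e \<eta>)) | _ \<Rightarrow> \<bottom>)"
| "den (CaseAmb M N) \<eta> =
    (case den M \<eta> of DAmb d e \<Rightarrow> den N (case_nat d (case_nat e \<eta>)) | _ \<Rightarrow> \<bottom>)"

text \<open>Denotation of closed programs, see \<open>den_closed\<close>.\<close>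

definition den0 :: "prog \<Rightarrow> D" where
  "den0 M = den M (\<lambda>_. \<bottom>)"

lemma den_cong: "(\<And>n. n \<in> fv M \<Longrightarrow> \<eta> n = \<eta>' n) \<Longrightarrow> den M \<eta> = den M \<eta>'"
proof (induction M arbitrary: \<eta> \<eta>')
  case (Lam M)
  have "den M (case_nat d \<eta>) = den M (case_nat d \<eta>')" for d
    by (rule Lam.IH) (use Lam.prems in \<open>auto split: nat.split\<close>)
  then show ?case by simp
next
  case (CaseLR M L R)
  have "den M \<eta> = den M \<eta>'" by (rule CaseLR.IH(1)) (use CaseLR.prems in auto)
  moreover have "den L (case_nat d \<eta>) = den L (case_nat d \<eta>')" for d
    by (rule CaseLR.IH(2)) (use CaseLR.prems in \<open>auto split: nat.split\<close>)
  moreover have "den R (case_nat d \<eta>) = den R (case_nat d \<eta>')" for d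
    by (rule CaseLR.IH(3)) (use CaseLR.prems in \<open>auto split: nat.split\<close>)
  ultimately show ?case by (simp split: D.split)
next
  case (CasePair M N)
  have "den M \<eta> = den M \<eta>'" by (rule CasePair.IH(1)) (use CasePair.prems in auto)
  moreover have "den N (case_nat d (case_nat e \<eta>)) = den N (case_nat d (case_nat e \<eta>'))" for d e
    by (rule CasePair.IH(2)) (use CasePair.prems in \<open>auto split: nat.split\<close>)
  ultimately show ?case by (simp split: D.split)
next
  case (CaseAmb M N)
  have "den M \<eta> = den M \<eta>'" by (rule CaseAmb.IH(1)) (use CaseAmb.prems in auto)
  moreover have "den N (case_nat d (case_nat e \<eta>)) = den N (case_nat d (case_nat e \<eta>'))" for d e
    by (rule CaseAmb.IH(2)) (use CaseAmb.prems in \<open>auto split: nat.split\<close>)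
  ultimately show ?case by (simp split: D.split)
next
  case (App M N)
  have "den M \<eta> = den M \<eta>'" "den N \<eta> = den N \<eta>'"
    by (rule App.IH; use App.prems in auto)+
  then show ?case by (simp split: D.split)
next
  case (SApp M N)
  have "den M \<eta> = den M \<eta>'" "den N \<eta> = den N \<eta>'"
    by (rule SApp.IH; use SApp.prems in auto)+
  then show ?case by (simp split: D.split)
next
  case (Rec M)
  have "den M \<eta> = den M \<eta>'" by (rule Rec.IH) (use Rec.prems in auto)
  then show ?case by (simp split: D.split)
next
  case (LeftP M)
  have "den M \<eta> = den M \<eta>'" by (rule LeftP.IH) (use LeftP.prems in auto)
  then show ?case by simp
next
  case (RightP M)
  have "den M \<eta> = den M \<eta>'" by (rule RightP.IH) (use RightP.prems in auto)
  then show ?case by simp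
next
  case (PairP M N)
  have "den M \<eta> = den M \<eta>'" "den N \<eta> = den N \<eta>'"
    by (rule PairP.IH; use PairP.prems in auto)+
  then show ?case by simp
next
  case (AmbP M N)
  have "den M \<eta> = den M \<eta>'" "den N \<eta> = den N \<eta>'"
    by (rule AmbP.IH; use AmbP.prems in auto)+
  then show ?case by simp
qed auto

lemma den_closed: "closed_prog M \<Longrightarrow> den M \<eta> = den0 M"
  unfolding den0_def by (rule den_cong) (simp add: closed_prog_def)

text \<open>
  All functions to which \<^term>\<open>Cfun\<close> is applied in the definition of \<^term>\<open>den\<close> are continuous
  (lemma \<open>den_Lam_cont\<close>), and the least fixed points exist (lemma \<open>LEAST_fixp\<close>).
\<close>

lemma LEAST_fixp:
  assumes g: "scott_cont g"
  shows "mono (\<lambda>n. (g ^^ n) \<bottom>)"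
    and "(LEAST d. g d = d) = (\<Squnion>n. (g ^^ n) \<bottom>)"
    and "g (LEAST d. g d = d) = (LEAST d. g d = d)"
    and "g e = e \<Longrightarrow> (LEAST d. g d = d) \<le> e"
proof -
  have step: "(g ^^ n) \<bottom> \<le> (g ^^ Suc n) \<bottom>" for n
    by (induction n) (auto intro: cont_monoD[OF g])
  show mono: "mono (\<lambda>n. (g ^^ n) \<bottom>)"
    unfolding mono_iff_le_Suc using step by blast
  note ch = chain_range_nat[OF mono]
  let ?s = "\<Squnion>n. (g ^^ n) \<bottom>"
  have low: "?s \<le> e" if "g e = e" for e
  proof (rule ccpo_Sup_least[OF ch])
    have "(g ^^ n) \<bottom> \<le> e" for n
      by (induction n) (use cont_monoD[OF g, of _ e] that in auto)
    then show "x \<in> range (\<lambda>n. (g ^^ n) \<bottom>) \<Longrightarrow> x \<le> e" for x by blast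
  qed
  have eq: "g ?s = (\<Squnion>n. (g ^^ Suc n) \<bottom>)"
    using mcont_contD[OF g ch] by (simp add: image_image)
  have mono': "mono (\<lambda>n. (g ^^ Suc n) \<bottom>)" using mono unfolding mono_iff_le_Suc by blast
  have "?s = g ?s"
  proof (rule order.antisym)
    show "?s \<le> g ?s"
      unfolding eq
      by (rule ccpo_Sup_least[OF ch])
        (use step ccpo_Sup_upper[OF chain_range_nat[OF mono']] order_trans in blast)
    show "g ?s \<le> ?s"
      unfolding eq
      by (rule ccpo_Sup_least[OF chain_range_nat[OF mono']]) (use ccpo_Sup_upper[OF ch] in blast)
  qed
  then show L: "(LEAST d. g d = d) = ?s"
    by (intro Least_equality) (use low in auto)
  show "g (LEAST d. g d = d) = (LEAST d. g d = d)" using \<open>?s = g ?s\<close> L by simp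
  show "g e = e \<Longrightarrow> (LEAST d. g d = d) \<le> e" using low L by simp
qed

lemma fun_of_DFun: "fun_of (DFun f) d = f \<bullet> d"
proof (rule D_eqI)
  fix t
  have "t \<in> toks (f \<bullet> d) \<longleftrightarrow> (\<exists>xs. set xs \<subseteq> toks d \<and> t \<in> toks (f \<bullet> el xs))"
  proof
    assume "t \<in> toks (f \<bullet> d)"
    then show "\<exists>xs. set xs \<subseteq> toks d \<and> t \<in> toks (f \<bullet> el xs)" by (rule cont_finitaryD[OF cont_app])
  next
    assume "\<exists>xs. set xs \<subseteq> toks d \<and> t \<in> toks (f \<bullet> el xs)"
    then show "t \<in> toks (f \<bullet> d)" using D_leD[OF app_mono[OF el_le]] by blast
  qed
  then show "t \<in> toks (fun_of (DFun f) d) \<longleftrightarrow> t \<in> toks (f \<bullet> d)"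
    using consis_toks by (auto simp: toks_fun_of toks_D fun_toks_def)
qed

lemma fun_of_bot: "Tag FunT \<notin> toks u \<Longrightarrow> fun_of u d = \<bottom>"
  using Tag_memI[of "Step _ _" u] by (intro D_eqI) (auto simp: toks_fun_of)

lemma case_fun_of: "(case u of DFun f \<Rightarrow> f \<bullet> d | _ \<Rightarrow> \<bottom>) = fun_of u d"
  by (cases u) (auto simp: fun_of_DFun fun_of_bot Tag_mem_D)

lemma argD_simps:
  "argD LeftT 0 (DLeft d) = d"
  "argD RightT 0 (DRight d) = d"
  "argD PairT 0 (DPair d e) = d"
  "argD PairT (Suc 0) (DPair d e) = e"
  "argD AmbT 0 (DAmb d e) = d"
  "argD AmbT (Suc 0) (DAmb d e) = e"
  by (auto intro!: D_eqI simp: toks_argD toks_D con_toks_def)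

lemma toks_el_mono: "set xs \<subseteq> set ys \<Longrightarrow> set ys \<subseteq> toks d \<Longrightarrow> el xs \<le> el ys"
  using consis_toks[of "set ys" d] clos_incl[of "set ys"] by (intro el_le) (auto simp: toks_el)

lemma cont_finitary2:
  assumes "scott_cont f" "scott_cont g" "s \<in> toks (f d)" "t \<in> toks (g d)"
  shows "\<exists>xs. set xs \<subseteq> toks d \<and> s \<in> toks (f (el xs)) \<and> t \<in> toks (g (el xs))"
proof -
  obtain xs where xs: "set xs \<subseteq> toks d" "s \<in> toks (f (el xs))"
    using cont_finitaryD[OF assms(1,3)] by blast
  obtain ys where ys: "set ys \<subseteq> toks d" "t \<in> toks (g (el ys))"
    using cont_finitaryD[OF assms(2,4)] by blast
  have sub: "set (xs @ ys) \<subseteq> toks d" using xs ys by simp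
  have "el xs \<le> el (xs @ ys)" "el ys \<le> el (xs @ ys)"
    using toks_el_mono[OF _ sub] by simp_all
  then have "s \<in> toks (f (el (xs @ ys)))" "t \<in> toks (g (el (xs @ ys)))"
    using D_leD[OF cont_monoD] assms(1,2) xs ys by blast+
  with sub show ?thesis by blast
qed

lemma cont_finitary_set:
  assumes f: "scott_cont f" and "set ys \<subseteq> toks (f d)"
  shows "\<exists>xs. set xs \<subseteq> toks d \<and> set ys \<subseteq> toks (f (el xs))"
  using assms(2)
proof (induction ys)
  case (Cons y ys)
  then obtain xs where xs: "set xs \<subseteq> toks d" "set ys \<subseteq> toks (f (el xs))" by auto
  obtain zs where zs: "set zs \<subseteq> toks d" "y \<in> toks (f (el zs))"
    using cont_finitaryD[OF f, of y d] Cons.prems by auto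
  have sub: "set (xs @ zs) \<subseteq> toks d" using xs zs by simp
  have "el xs \<le> el (xs @ zs)" "el zs \<le> el (xs @ zs)"
    using toks_el_mono[OF _ sub] by simp_all
  then have "set (y # ys) \<subseteq> toks (f (el (xs @ zs)))"
    using D_leD[OF cont_monoD[OF f]] xs zs by auto
  with sub show ?case by blast
qed (auto intro: exI[of _ "[]"])

lemma cont_fun_of2:
  assumes f: "scott_cont f" and g: "scott_cont g"
  shows "scott_cont (\<lambda>d. fun_of (f d) (g d))"
proof (rule scott_contI)
  fix d e :: D assume "d \<le> e"
  then show "fun_of (f d) (g d) \<le> fun_of (f e) (g e)"
    using cont_monoD[OF f] cont_monoD[OF g] by (auto simp: less_eq_D.rep_eq toks_fun_of) blast
next
  fix d t assume "t \<in> toks (fun_of (f d) (g d))"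
  then obtain zs where zs: "Step zs t \<in> toks (f d)" "set zs \<subseteq> toks (g d)"
    by (auto simp: toks_fun_of)
  obtain xs where xs: "set xs \<subseteq> toks d" "Step zs t \<in> toks (f (el xs))"
    using cont_finitaryD[OF f zs(1)] by blast
  obtain ys where ys: "set ys \<subseteq> toks d" "set zs \<subseteq> toks (g (el ys))"
    using cont_finitary_set[OF g zs(2)] by blast
  have sub: "set (xs @ ys) \<subseteq> toks d" using xs ys by simp
  have "el xs \<le> el (xs @ ys)" "el ys \<le> el (xs @ ys)"
    using toks_el_mono[OF _ sub] by simp_all
  then have "Step zs t \<in> toks (f (el (xs @ ys)))" "set zs \<subseteq> toks (g (el (xs @ ys)))"
    using D_leD[OF cont_monoD[OF f]] D_leD[OF cont_monoD[OF g]] xs ys by auto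
  then have "t \<in> toks (fun_of (f (el (xs @ ys))) (g (el (xs @ ys))))"
    by (auto simp: toks_fun_of)
  with sub show "\<exists>xs. set xs \<subseteq> toks d \<and> t \<in> toks (fun_of (f (el xs)) (g (el xs)))" by blast
qed

lemma cont_argD:
  assumes f: "scott_cont f"
  shows "scott_cont (\<lambda>d. argD c i (f d))"
proof (rule scott_contI)
  show "d \<le> e \<Longrightarrow> argD c i (f d) \<le> argD c i (f e)" for d e
    using cont_monoD[OF f, of d e] by (auto simp: less_eq_D.rep_eq toks_argD)
qed (use cont_finitaryD[OF f] in \<open>simp add: toks_argD\<close>)

lemma cont_guard:
  assumes f: "scott_cont f" and g: "scott_cont g" and h: "scott_cont h" and "c \<noteq> c'"
  shows "scott_cont
    (\<lambda>d. if Tag c \<in> toks (f d) then g d else if Tag c' \<in> toks (f d) then h d else \<bottom>)"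
    (is "scott_cont ?k")
proof (rule scott_contI)
  fix d e :: D assume le: "d \<le> e"
  have "\<not> (Tag c \<in> toks u \<and> Tag c' \<in> toks u)" for u
    using toks_coh[of "Tag c" u "Tag c'"] assms(4) by auto
  moreover have "Tag c \<in> toks (f d) \<Longrightarrow> Tag c \<in> toks (f e)" for c
    using D_leD[OF cont_monoD[OF f le]] .
  ultimately show "?k d \<le> ?k e"
    using cont_monoD[OF g le] cont_monoD[OF h le] by auto
next
  fix d t assume t: "t \<in> toks (?k d)"
  have excl: "\<not> (Tag c \<in> toks u \<and> Tag c' \<in> toks u)" for u
    using toks_coh[of "Tag c" u "Tag c'"] assms(4) by auto
  show "\<exists>xs. set xs \<subseteq> toks d \<and> t \<in> toks (?k (el xs))"
  proof (cases "Tag c \<in> toks (f d)")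
    case True
    then show ?thesis using cont_finitary2[OF f g True, of t] t by auto
  next
    case False
    then have c': "Tag c' \<in> toks (f d)" and "t \<in> toks (h d)" using t by (auto split: if_splits)
    then obtain xs where "set xs \<subseteq> toks d" "Tag c' \<in> toks (f (el xs))" "t \<in> toks (h (el xs))"
      using cont_finitary2[OF f h] by blast
    then show ?thesis using excl by (intro exI[of _ xs]) auto
  qed
qed

lemma cont_strict:
  assumes f: "scott_cont f" and g: "scott_cont g"
  shows "scott_cont (\<lambda>d. if f d \<noteq> \<bottom> then g d else \<bottom>)"
proof (rule scott_contI)
  show "(if f d \<noteq> \<bottom> then g d else \<bottom>) \<le> (if f e \<noteq> \<bottom> then g e else \<bottom>)" if "d \<le> e" for d e
    using cont_monoD[OF f that] cont_monoD[OF g that] by (auto simp: bot_unique)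
next
  fix d t assume t: "t \<in> toks (if f d \<noteq> \<bottom> then g d else \<bottom>)"
  then have "f d \<noteq> \<bottom>" "t \<in> toks (g d)" by (auto split: if_splits)
  then obtain s where s: "s \<in> toks (f d)" using D_eqI[of "f d" \<bottom>] by auto
  obtain xs where xs: "set xs \<subseteq> toks d" "s \<in> toks (f (el xs))" "t \<in> toks (g (el xs))"
    using cont_finitary2[OF f g s \<open>t \<in> toks (g d)\<close>] by blast
  then have "f (el xs) \<noteq> \<bottom>" by force
  with xs show "\<exists>xs. set xs \<subseteq> toks d \<and> t \<in> toks (if f (el xs) \<noteq> \<bottom> then g (el xs) else \<bottom>)" by auto
qed

lemma case_rec:
  "(case u of DFun f \<Rightarrow> (LEAST d. f \<bullet> d = d) | _ \<Rightarrow> \<bottom>) = (\<Squnion>n. (fun_of u ^^ n) \<bottom>)"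
proof (cases "Tag FunT \<in> toks u")
  case True
  then obtain f where u: "u = DFun f" by (cases u) (auto simp: Tag_mem_D)
  then have "fun_of u = app f" using fun_of_DFun by auto
  then show ?thesis using LEAST_fixp(2)[OF cont_app[of f]] u by simp
next
  case False
  then have "(fun_of u ^^ n) \<bottom> = \<bottom>" for n by (induction n) (auto simp: fun_of_bot)
  then show ?thesis using False by (cases u) (auto simp: Tag_mem_D)
qed

lemma cont_rec:
  assumes f: "scott_cont f"
  shows "scott_cont (\<lambda>d. \<Squnion>n. (fun_of (f d) ^^ n) \<bottom>)"
proof -
  have it: "scott_cont (\<lambda>d. (fun_of (f d) ^^ n) \<bottom>)" for n
    by (induction n) (simp_all add: cont_const cont_fun_of2[OF f])
  have toks: "toks (\<Squnion>n. (fun_of (f d) ^^ n) \<bottom>) = (\<Union>n. toks ((fun_of (f d) ^^ n) \<bottom>))" for d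
    using toks_Sup[OF chain_range_nat[OF LEAST_fixp(1)[OF cont_fun_of[of "f d"]]]]
    by (simp add: image_image)
  show ?thesis
  proof (rule scott_contI)
    show "(\<Squnion>n. (fun_of (f d) ^^ n) \<bottom>) \<le> (\<Squnion>n. (fun_of (f e) ^^ n) \<bottom>)" if "d \<le> e" for d e
      using D_leD[OF cont_monoD[OF it that]] by (intro D_leI) (auto simp: toks)
  next
    fix d t assume "t \<in> toks (\<Squnion>n. (fun_of (f d) ^^ n) \<bottom>)"
    then obtain n where "t \<in> toks ((fun_of (f d) ^^ n) \<bottom>)" by (auto simp: toks)
    from cont_finitaryD[OF it this]
    show "\<exists>xs. set xs \<subseteq> toks d \<and> t \<in> toks (\<Squnion>n. (fun_of (f (el xs)) ^^ n) \<bottom>)"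
      by (auto simp: toks)
  qed
qed

lemma cont_con:
  assumes f: "scott_cont f" and g: "scott_cont g"
  shows "scott_cont (\<lambda>d. DLeft (f d))" "scott_cont (\<lambda>d. DRight (f d))"
    "scott_cont (\<lambda>d. DPair (f d) (g d))" "scott_cont (\<lambda>d. DAmb (f d) (g d))"
proof -
  have *: "\<exists>xs. set xs \<subseteq> toks d \<and> t \<in> con_toks c [f (el xs), g (el xs)]"
    if t: "t \<in> con_toks c [f d, g d]" for c d t
  proof -
    consider "t = Tag c" | s where "t = Arg c 0 s" "s \<in> toks (f d)"
      | s where "t = Arg c (Suc 0) s" "s \<in> toks (g d)"
      using t by (auto simp: con_toks_def less_Suc_eq)
    then show ?thesis
    proof cases
      case 1
      then show ?thesis by (intro exI[of _ "[]"]) (simp add: con_toks_def)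
    next
      case 2
      then show ?thesis using cont_finitaryD[OF f, of s d] by (fastforce simp: con_toks_def)
    next
      case 3
      then show ?thesis using cont_finitaryD[OF g, of s d] by (fastforce simp: con_toks_def)
    qed
  qed
  have **: "\<exists>xs. set xs \<subseteq> toks d \<and> t \<in> con_toks c [f (el xs)]"
    if t: "t \<in> con_toks c [f d]" for c d t
  proof -
    consider "t = Tag c" | s where "t = Arg c 0 s" "s \<in> toks (f d)"
      using t by (auto simp: con_toks_def)
    then show ?thesis
    proof cases
      case 1
      then show ?thesis by (intro exI[of _ "[]"]) (simp add: con_toks_def)
    next
      case 2
      then show ?thesis using cont_finitaryD[OF f, of s d] by (fastforce simp: con_toks_def)
    qed
  qed
  show "scott_cont (\<lambda>d. DLeft (f d))" "scott_cont (\<lambda>d. DRight (f d))"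
    by (rule scott_contI;
        simp add: DLeft_le_iff DRight_le_iff cont_monoD[OF f] toks_D **)+
  show "scott_cont (\<lambda>d. DPair (f d) (g d))" "scott_cont (\<lambda>d. DAmb (f d) (g d))"
    by (rule scott_contI;
        simp add: DPair_le_iff DAmb_le_iff cont_monoD[OF f] cont_monoD[OF g] toks_D *)+
qed

lemma cont_lam:
  assumes k: "\<And>d. scott_cont (\<lambda>e. k d e)" and k': "\<And>e. scott_cont (\<lambda>d. k d e)"
  shows "scott_cont (\<lambda>d. DFun (Cfun (k d)))"
proof (rule scott_contI)
  show "d \<le> e \<Longrightarrow> DFun (Cfun (k d)) \<le> DFun (Cfun (k e))" for d e
    using cont_monoD[OF k'] by (simp add: DFun_le_iff k)
next
  fix d t assume "t \<in> toks (DFun (Cfun (k d)))"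
  then consider "t = Tag FunT"
    | ys s where "t = Step ys s" "consis (set ys)" "s \<in> toks (k d (el ys))"
    by (auto simp: toks_D fun_toks_def k)
  then show "\<exists>xs. set xs \<subseteq> toks d \<and> t \<in> toks (DFun (Cfun (k (el xs))))"
  proof cases
    case 1
    then show ?thesis by (intro exI[of _ "[]"]) (simp add: Tag_mem_D)
  next
    case 2
    then show ?thesis
      using cont_finitaryD[OF k', of s d "el ys"] by (auto simp: toks_D fun_toks_def k)
  qed
qed

lemma case_LR:
  "(case u of DLeft d \<Rightarrow> k d | DRight d \<Rightarrow> l d | _ \<Rightarrow> \<bottom>) =
    (if Tag LeftT \<in> toks u then k (argD LeftT 0 u)
     else if Tag RightT \<in> toks u then l (argD RightT 0 u) else \<bottom>)"
  by (cases u) (auto simp: Tag_mem_D argD_simps)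

lemma case_Pair:
  "(case u of DPair d e \<Rightarrow> k d e | _ \<Rightarrow> \<bottom>) =
    (if Tag PairT \<in> toks u then k (argD PairT 0 u) (argD PairT (Suc 0) u)
     else if Tag NilT \<in> toks u then \<bottom> else \<bottom>)"
  by (cases u) (auto simp: Tag_mem_D argD_simps)

lemma case_Amb:
  "(case u of DAmb d e \<Rightarrow> k d e | _ \<Rightarrow> \<bottom>) =
    (if Tag AmbT \<in> toks u then k (argD AmbT 0 u) (argD AmbT (Suc 0) u)
     else if Tag NilT \<in> toks u then \<bottom> else \<bottom>)"
  by (cases u) (auto simp: Tag_mem_D argD_simps)

lemma case_SApp:
  "(case u of DFun f \<Rightarrow> if d \<noteq> \<bottom> then f \<bullet> d else \<bottom> | _ \<Rightarrow> \<bottom>) = (if d \<noteq> \<bottom> then fun_of u d else \<bottom>)"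
  by (cases u) (auto simp: fun_of_DFun fun_of_bot Tag_mem_D)

lemma cont_case_nat:
  "scott_cont h \<Longrightarrow> (\<And>n. scott_cont (\<lambda>d. \<eta> d n)) \<Longrightarrow> scott_cont (\<lambda>d. case_nat (h d) (\<eta> d) n)"
  by (cases n) simp_all

lemma den_cont: "(\<And>n. scott_cont (\<lambda>d. \<eta> d n)) \<Longrightarrow> scott_cont (\<lambda>d. den M (\<eta> d))"
proof (induction M arbitrary: \<eta>)
  case (Lam M)
  then show ?case
    by (simp, intro cont_lam Lam.IH cont_case_nat cont_const mcont_id' Lam.prems)
next
  case (App M N)
  then show ?case by (simp add: case_fun_of cont_fun_of2)
next
  case (SApp M N)
  then show ?case unfolding den.simps case_SApp by (intro cont_strict cont_fun_of2) auto
next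
  case (Rec M)
  then show ?case unfolding den.simps case_rec by (intro cont_rec) auto
next
  case (CaseLR M L R)
  show ?case unfolding den.simps case_LR
    by (intro cont_guard CaseLR.IH cont_case_nat cont_argD CaseLR.prems) simp
next
  case (CasePair M N)
  show ?case unfolding den.simps case_Pair
    by (intro cont_guard cont_const CasePair.IH cont_case_nat cont_argD CasePair.prems) simp
next
  case (CaseAmb M N)
  show ?case unfolding den.simps case_Amb
    by (intro cont_guard cont_const CaseAmb.IH cont_case_nat cont_argD CaseAmb.prems) simp
qed (simp_all add: cont_con cont_con(1,2)[OF _ cont_const] cont_const)

lemma den_Lam_cont: "scott_cont (\<lambda>d. den M (case_nat d \<eta>))"
  by (intro den_cont cont_case_nat mcont_id' cont_const)


section \<open>Operational semantics\<close>

fun con_headed :: "prog \<Rightarrow> bool" where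
  "con_headed NilP = True"
| "con_headed (LeftP _) = True"
| "con_headed (RightP _) = True"
| "con_headed (PairP _ _) = True"
| "con_headed (AmbP _ _) = True"
| "con_headed _ = False"

definition whnf :: "prog \<Rightarrow> bool" where
  "whnf M \<longleftrightarrow> con_headed M \<or> (\<exists>N. M = Lam N)"

fun bot_like :: "prog \<Rightarrow> bool" where
  "bot_like Bot \<longleftrightarrow> True"
| "bot_like (App M N) \<longleftrightarrow> con_headed M"
| "bot_like (SApp M N) \<longleftrightarrow> con_headed M"
| "bot_like (CaseLR M L R) \<longleftrightarrow> whnf M \<and> (\<forall>M'. M \<noteq> LeftP M' \<and> M \<noteq> RightP M')"
| "bot_like (CasePair M N) \<longleftrightarrow> whnf M \<and> (\<forall>M\<^sub>1 M\<^sub>2. M \<noteq> PairP M\<^sub>1 M\<^sub>2)"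
| "bot_like (CaseAmb M N) \<longleftrightarrow> whnf M \<and> (\<forall>M\<^sub>1 M\<^sub>2. M \<noteq> AmbP M\<^sub>1 M\<^sub>2)"
| "bot_like _ \<longleftrightarrow> False"

inductive step :: "prog \<Rightarrow> prog \<Rightarrow> bool" (infix "\<leadsto>" 50) where
  step_beta: "App (Lam M) N \<leadsto> subst1 M N"
| step_App: "M \<leadsto> M' \<Longrightarrow> App M N \<leadsto> App M' N"
| step_sbeta: "whnf N \<Longrightarrow> SApp (Lam M) N \<leadsto> subst1 M N"
| step_SApp1: "whnf N \<Longrightarrow> M \<leadsto> M' \<Longrightarrow> SApp M N \<leadsto> SApp M' N"
| step_SApp2: "N \<leadsto> N' \<Longrightarrow> SApp M N \<leadsto> SApp M N'"
| step_Rec: "Rec M \<leadsto> App M (Rec M)"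
| step_CaseLeft: "CaseLR (LeftP M) L R \<leadsto> subst1 L M"
| step_CaseRight: "CaseLR (RightP M) L R \<leadsto> subst1 R M"
| step_CasePair: "CasePair (PairP M\<^sub>1 M\<^sub>2) N \<leadsto> subst2 N M\<^sub>1 M\<^sub>2"
| step_CaseAmb: "CaseAmb (AmbP M\<^sub>1 M\<^sub>2) N \<leadsto> subst2 N M\<^sub>1 M\<^sub>2"
| step_in_CaseLR: "M \<leadsto> M' \<Longrightarrow> CaseLR M L R \<leadsto> CaseLR M' L R"
| step_in_CasePair: "M \<leadsto> M' \<Longrightarrow> CasePair M N \<leadsto> CasePair M' N"
| step_in_CaseAmb: "M \<leadsto> M' \<Longrightarrow> CaseAmb M N \<leadsto> CaseAmb M' N"
| step_bot: "bot_like M \<Longrightarrow> M \<leadsto> Bot"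

inductive cstep :: "prog \<Rightarrow> prog \<Rightarrow> bool" (infix "\<leadsto>\<^sub>c" 50) where
  cstep_step: "M \<leadsto> M' \<Longrightarrow> M \<leadsto>\<^sub>c M'"
| cstep_Amb1: "M\<^sub>1 \<leadsto> M\<^sub>1' \<Longrightarrow> AmbP M\<^sub>1 M\<^sub>2 \<leadsto>\<^sub>c AmbP M\<^sub>1' M\<^sub>2"
| cstep_Amb2: "M\<^sub>2 \<leadsto> M\<^sub>2' \<Longrightarrow> AmbP M\<^sub>1 M\<^sub>2 \<leadsto>\<^sub>c AmbP M\<^sub>1 M\<^sub>2'"
| cstep_choose1: "whnf M\<^sub>1 \<Longrightarrow> AmbP M\<^sub>1 M\<^sub>2 \<leadsto>\<^sub>c M\<^sub>1"
| cstep_choose2: "whnf M\<^sub>2 \<Longrightarrow> AmbP M\<^sub>1 M\<^sub>2 \<leadsto>\<^sub>c M\<^sub>2"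

inductive pstep :: "prog \<Rightarrow> prog \<Rightarrow> bool" (infix "\<leadsto>\<^sub>p" 50) where
  pstep_cstep: "M \<leadsto>\<^sub>c M' \<Longrightarrow> M \<leadsto>\<^sub>p M'"
| pstep_Nil: "NilP \<leadsto>\<^sub>p NilP"
| pstep_Left: "M \<leadsto>\<^sub>p M' \<Longrightarrow> LeftP M \<leadsto>\<^sub>p LeftP M'"
| pstep_Right: "M \<leadsto>\<^sub>p M' \<Longrightarrow> RightP M \<leadsto>\<^sub>p RightP M'"
| pstep_Pair: "M\<^sub>1 \<leadsto>\<^sub>p M\<^sub>1' \<Longrightarrow> M\<^sub>2 \<leadsto>\<^sub>p M\<^sub>2' \<Longrightarrow> PairP M\<^sub>1 M\<^sub>2 \<leadsto>\<^sub>p PairP M\<^sub>1' M\<^sub>2'"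
| pstep_Lam: "Lam M \<leadsto>\<^sub>p Lam M"

definition pseq :: "(nat \<Rightarrow> prog) \<Rightarrow> bool" where
  "pseq S \<longleftrightarrow> (\<forall>i. S i \<leadsto>\<^sub>p S (Suc i))"

text \<open>
  \<open>S\<close> ranges over sequences with \<^term>\<open>pseq S\<close>; the first two rules imply this.
\<close>

inductive unfair :: "(nat \<Rightarrow> prog) \<Rightarrow> bool" where
  unfair_Amb1: "(\<And>i. S i = AmbP (L i) R) \<Longrightarrow> (\<And>i. L i \<leadsto> L (Suc i)) \<Longrightarrow> unfair S"
| unfair_Amb2: "(\<And>i. S i = AmbP L (R i)) \<Longrightarrow> (\<And>i. R i \<leadsto> R (Suc i)) \<Longrightarrow> unfair S"
| unfair_Left: "pseq S \<Longrightarrow> (\<And>i. S i = LeftP (N i)) \<Longrightarrow> unfair N \<Longrightarrow> unfair S"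
| unfair_Right: "pseq S \<Longrightarrow> (\<And>i. S i = RightP (N i)) \<Longrightarrow> unfair N \<Longrightarrow> unfair S"
| unfair_Pair1: "pseq S \<Longrightarrow> (\<And>i. S i = PairP (N i) (N' i)) \<Longrightarrow> unfair N \<Longrightarrow> unfair S"
| unfair_Pair2: "pseq S \<Longrightarrow> (\<And>i. S i = PairP (N i) (N' i)) \<Longrightarrow> unfair N' \<Longrightarrow> unfair S"
| unfair_tail: "pseq S \<Longrightarrow> unfair (\<lambda>i. S (Suc i)) \<Longrightarrow> unfair S"

definition computation :: "prog \<Rightarrow> (nat \<Rightarrow> prog) \<Rightarrow> bool" where
  "computation M S \<longleftrightarrow> S 0 = M \<and> pseq S \<and> \<not> unfair S"

text \<open>\<open>obs M\<close> is the element \<open>M\<^sub>D\<close>.\<close>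

fun obs :: "prog \<Rightarrow> D" where
  "obs NilP = DNil"
| "obs (LeftP M) = DLeft (obs M)"
| "obs (RightP M) = DRight (obs M)"
| "obs (PairP M N) = DPair (obs M) (obs N)"
| "obs (Lam M) = den0 (Lam M)"
| "obs _ = \<bottom>"

lemma step_obs: "M \<leadsto> M' \<Longrightarrow> obs M = \<bottom>"
proof (induction rule: step.induct)
  case (step_bot M)
  then show ?case by (cases M) auto
qed auto

lemma obs_mono: "M \<leadsto>\<^sub>p M' \<Longrightarrow> obs M \<le> obs M'"
proof (induction rule: pstep.induct)
  case (pstep_cstep M M')
  then show ?case by (cases rule: cstep.cases) (auto simp: step_obs)
qed (auto simp: DLeft_le_iff DRight_le_iff DPair_le_iff)

lemma chain_obs: "computation M S \<Longrightarrow> mono (\<lambda>i. obs (S i))"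
  unfolding mono_iff_le_Suc computation_def pseq_def using obs_mono by blast


section \<open>The relation data\<close>

coinductive in_data :: "D \<Rightarrow> D \<Rightarrow> bool" where
  in_data_Amb1: "a' \<noteq> \<bottom> \<Longrightarrow> in_data d a' \<Longrightarrow> in_data d (DAmb a' b')"
| in_data_Amb2: "b' \<noteq> \<bottom> \<Longrightarrow> in_data d b' \<Longrightarrow> in_data d (DAmb a' b')"
| in_data_Amb_bot: "in_data \<bottom> (DAmb \<bottom> \<bottom>)"
| in_data_Nil: "in_data DNil DNil"
| in_data_Left: "in_data d a \<Longrightarrow> in_data (DLeft d) (DLeft a)"
| in_data_Right: "in_data d a \<Longrightarrow> in_data (DRight d) (DRight a)"
| in_data_Pair: "in_data d a \<Longrightarrow> in_data e b \<Longrightarrow> in_data (DPair d e) (DPair a b)"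
| in_data_Fun: "in_data (DFun f) (DFun f)"
| in_data_bot: "in_data \<bottom> \<bottom>"

definition data :: "D \<Rightarrow> D set" where
  "data a = {d. in_data d a}"

end

theory Submission
  imports Defs
begin

text \<open>
  Reduction preserves denotations, and it is deterministic on programs with a denotation other than
  bottom.  Together with computational adequacy (a program whose denotation is not bottom reduces to a
  weak head normal form), this shows that a computation that never reaches a weak head normal form
  starts from a program denoting bottom.  From a weak head normal form headed by a data constructor
  the computation splits into fair computations of the components.  From \<open>Amb\<close>, either one of
  the arguments is eventually chosen, and the computation continues with a program that denotes the
  same non-bottom element as that argument, or by fairness both arguments are reduced forever and
  denote bottom.  Hence the pairs of the limit of a fair computation and the denotation of its first
  program satisfy the closure condition of which \<open>data\<close> is the largest solution.
\<close>

section \<open>Substitution\<close>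

lemma up_ren_simps [simp]: "up_ren r 0 = 0" "up_ren r (Suc n) = Suc (r n)"
  by (simp_all add: up_ren_def)

lemma up_subst_simps [simp]: "up_subst s 0 = Var 0" "up_subst s (Suc n) = ren Suc (s n)"
  by (simp_all add: up_subst_def)

lemma up_ren_comp: "(\<lambda>n. up_ren r (up_ren q n)) = up_ren (\<lambda>n. r (q n))"
proof
  show "up_ren r (up_ren q n) = up_ren (\<lambda>n. r (q n)) n" for n by (cases n) simp_all
qed

lemma ren_ren: "ren r (ren q M) = ren (\<lambda>n. r (q n)) M"
  by (induction M arbitrary: r q) (simp_all add: up_ren_comp)

lemma up_subst_up_ren: "(\<lambda>n. up_subst s (up_ren r n)) = up_subst (\<lambda>n. s (r n))"
proof
  show "up_subst s (up_ren r n) = up_subst (\<lambda>n. s (r n)) n" for n by (cases n) simp_all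
qed

lemma subst_ren: "subst s (ren r M) = subst (\<lambda>n. s (r n)) M"
  by (induction M arbitrary: s r) (simp_all add: up_subst_up_ren)

lemma ren_up_subst: "(\<lambda>n. ren (up_ren r) (up_subst s n)) = up_subst (\<lambda>n. ren r (s n))"
proof
  show "ren (up_ren r) (up_subst s n) = up_subst (\<lambda>n. ren r (s n)) n" for n
    by (cases n) (simp_all add: ren_ren)
qed

lemma ren_subst: "ren r (subst s M) = subst (\<lambda>n. ren r (s n)) M"
  by (induction M arbitrary: s r) (simp_all add: ren_up_subst)

lemma subst_up_subst: "(\<lambda>n. subst (up_subst s) (up_subst u n)) = up_subst (\<lambda>n. subst s (u n))"
proof
  show "subst (up_subst s) (up_subst u n) = up_subst (\<lambda>n. subst s (u n)) n" for n
    by (cases n) (simp_all add: subst_ren ren_subst)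
qed

lemma subst_subst: "subst s (subst u M) = subst (\<lambda>n. subst s (u n)) M"
  by (induction M arbitrary: s u) (simp_all add: subst_up_subst)

lemma up_subst_Var [simp]: "up_subst Var = Var"
proof
  show "up_subst Var n = Var n" for n by (cases n) simp_all
qed

lemma subst_Var [simp]: "subst Var M = M"
  by (induction M) simp_all

text \<open>Turns the reduct of a substituted redex into one simultaneous substitution, the form in
  which the induction hypotheses of \<open>approx_den\<close> apply under a binder.\<close>

lemma subst1_up_subst: "subst1 (subst (up_subst s) M) N = subst (case_nat N s) M"
proof -
  have "subst (case_nat N Var) (up_subst s n) = case_nat N s n" for n
    by (cases n) (simp_all add: subst_ren)
  then show ?thesis by (simp add: subst1_def subst_subst)
qed

lemma subst2_up_subst:
  "subst2 (subst (up_subst (up_subst s)) M) N N' = subst (case_nat N (case_nat N' s)) M"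
proof -
  have "subst (case_nat N (case_nat N' Var)) (up_subst (up_subst s) n) = case_nat N (case_nat N' s) n"
    for n by (cases n; cases "n - 1") (simp_all add: subst_ren)
  then show ?thesis by (simp add: subst2_def subst_subst)
qed

section \<open>Denotation of renamed and substituted programs\<close>

lemma case_nat_up_ren: "(\<lambda>n. case_nat d \<eta> (up_ren r n)) = case_nat d (\<lambda>n. \<eta> (r n))"
proof
  show "case_nat d \<eta> (up_ren r n) = case_nat d (\<lambda>n. \<eta> (r n)) n" for n by (cases n) simp_all
qed

lemma den_ren: "den (ren r M) \<eta> = den M (\<lambda>n. \<eta> (r n))"
  by (induction M arbitrary: r \<eta>) (simp_all add: case_nat_up_ren cong: D.case_cong if_cong)

lemma den_up_subst:
  "(\<lambda>n. den (up_subst s n) (case_nat d \<eta>)) = case_nat d (\<lambda>n. den (s n) \<eta>)"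
proof
  show "den (up_subst s n) (case_nat d \<eta>) = case_nat d (\<lambda>n. den (s n) \<eta>) n" for n
    by (cases n) (simp_all add: den_ren)
qed

lemma den_subst: "den (subst s M) \<eta> = den M (\<lambda>n. den (s n) \<eta>)"
  by (induction M arbitrary: s \<eta>) (simp_all add: den_up_subst cong: D.case_cong if_cong)

lemma den_subst1: "den (subst1 M N) \<eta> = den M (case_nat (den N \<eta>) \<eta>)"
proof -
  have "(\<lambda>n. den (case_nat N Var n) \<eta>) = case_nat (den N \<eta>) \<eta>"
    by (rule ext) (simp split: nat.split)
  then show ?thesis by (simp add: subst1_def den_subst)
qed

lemma den_subst2:
  "den (subst2 M N N') \<eta> = den M (case_nat (den N \<eta>) (case_nat (den N' \<eta>) \<eta>))"
proof -
  have "(\<lambda>n. den (case_nat N (case_nat N' Var) n) \<eta>) = case_nat (den N \<eta>) (case_nat (den N' \<eta>) \<eta>)"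
    by (rule ext) (simp split: nat.split)
  then show ?thesis by (simp add: subst2_def den_subst)
qed


section \<open>Reduction and denotation\<close>

lemma whnf_iff:
  "whnf M \<longleftrightarrow> M = NilP \<or> (\<exists>N. M = LeftP N) \<or> (\<exists>N. M = RightP N) \<or> (\<exists>N N'. M = PairP N N') \<or>
    (\<exists>N N'. M = AmbP N N') \<or> (\<exists>N. M = Lam N)"
  by (cases M) (auto simp: whnf_def)

lemma den_whnf: "whnf M \<Longrightarrow> den M \<eta> \<noteq> \<bottom>"
  by (auto simp: whnf_iff)

lemma den_con_headed: "con_headed M \<Longrightarrow> den M \<eta> \<noteq> DFun f"
  by (cases M) auto

lemma den_bot_like: "bot_like M \<Longrightarrow> den M \<eta> = \<bottom>"
  by (cases M) (auto simp: whnf_iff den_con_headed split: D.split)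

text \<open>For \<open>Rec\<close> this is the fixed point equation. Strict beta is sound because an
  argument in weak head normal form never denotes bottom, so the strictness test succeeds.\<close>

lemma den_step: "M \<leadsto> M' \<Longrightarrow> den M \<eta> = den M' \<eta>"
proof (induction rule: step.induct)
  case (step_Rec M)
  then show ?case
    by (auto simp: LEAST_fixp(3) split: D.split)
qed (auto simp: den_subst1 den_subst2 den_Lam_cont den_whnf den_bot_like cong: D.case_cong if_cong)

lemma whnf_no_step: "whnf M \<Longrightarrow> \<not> M \<leadsto> M'"
  by (auto simp: whnf_iff elim: step.cases)

text \<open>
  Reduction is not deterministic: if \<open>M\<close> is headed by a constructor and \<open>N\<close> is reducible then
  \<open>SApp M N\<close> reduces both to \<open>Bot\<close> and inside \<open>N\<close>.
\<close>

lemma den_strict_args: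
  assumes "den M \<eta> = \<bottom>"
  shows "den (App M N) \<eta> = \<bottom>" "den (SApp M N) \<eta> = \<bottom>" "den (CaseLR M L R) \<eta> = \<bottom>"
    "den (CasePair M N) \<eta> = \<bottom>" "den (CaseAmb M N) \<eta> = \<bottom>" "den (SApp N M) \<eta> = \<bottom>"
  using assms by (auto split: D.split)

lemma con_headed_whnf: "con_headed M \<Longrightarrow> whnf M"
  by (simp add: whnf_def)

lemma whnf_simps [simp]:
  "whnf NilP" "whnf (LeftP M)" "whnf (RightP M)" "whnf (PairP M N)" "whnf (AmbP M N)" "whnf (Lam M)"
  by (simp_all add: whnf_def)

inductive_cases step_AppE: "App M N \<leadsto> K"
inductive_cases step_SAppE: "SApp M N \<leadsto> K"
inductive_cases step_RecE: "Rec M \<leadsto> K"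
inductive_cases step_CaseLRE: "CaseLR M L R \<leadsto> K"
inductive_cases step_CasePairE: "CasePair M N \<leadsto> K"
inductive_cases step_CaseAmbE: "CaseAmb M N \<leadsto> K"

text \<open>Apart from the overlap described above, at most one rule applies to a program, and that
  overlap concerns only programs denoting bottom. In the congruence cases strictness passes the
  non-bottom denotation on to the reduced subprogram, so the induction hypothesis applies.\<close>

lemma step_deterministic:
  "M \<leadsto> M\<^sub>1 \<Longrightarrow> M \<leadsto> M\<^sub>2 \<Longrightarrow> den M \<eta> \<noteq> \<bottom> \<Longrightarrow> M\<^sub>1 = M\<^sub>2"
proof (induction arbitrary: M\<^sub>2 rule: step.induct)
  case (step_bot M)
  then show ?case by (simp add: den_bot_like)
next
  case (step_beta M N)
  show ?case
    by (rule step_AppE[OF step_beta(1)]) (use step_beta in \<open>simp_all add: whnf_no_step\<close>)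
next
  case (step_App M M' N)
  have ne: "den M \<eta> \<noteq> \<bottom>"
    using step_App.prems(2) by (rule contrapos_nn) (rule den_strict_args(1))
  have n: "\<not> con_headed M" "\<not> whnf M"
    using whnf_no_step con_headed_whnf step_App.hyps by blast+
  show ?case
    by (rule step_AppE[OF step_App.prems(1)]) (use n in \<open>auto dest: step_App.IH[OF _ ne]\<close>)
next
  case (step_sbeta N M)
  show ?case
    by (rule step_SAppE[OF step_sbeta(2)]) (use step_sbeta in \<open>simp_all add: whnf_no_step\<close>)
next
  case (step_SApp1 N M M')
  have ne: "den M \<eta> \<noteq> \<bottom>"
    using step_SApp1.prems(2) by (rule contrapos_nn) (rule den_strict_args(2))
  have n: "\<not> con_headed M" "\<not> whnf M" "\<And>N'. \<not> N \<leadsto> N'"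
    using whnf_no_step con_headed_whnf step_SApp1.hyps by blast+
  show ?case
    by (rule step_SAppE[OF step_SApp1.prems(1)]) (use n in \<open>auto dest: step_SApp1.IH[OF _ ne]\<close>)
next
  case (step_SApp2 N N' M)
  have ne: "den N \<eta> \<noteq> \<bottom>"
    using step_SApp2.prems(2) by (rule contrapos_nn) (rule den_strict_args(6))
  \<comment> \<open>Excludes \<open>step_bot\<close>, the only other rule that applies while
    \<open>N\<close> is reducible.\<close>
  have n: "\<not> bot_like (SApp M N)"
    using step_SApp2.prems(2) by (rule contrapos_nn) (rule den_bot_like)
  have n': "\<not> whnf N" using whnf_no_step step_SApp2.hyps by blast
  show ?case
    by (rule step_SAppE[OF step_SApp2.prems(1)]) (use n n' in \<open>auto dest: step_SApp2.IH[OF _ ne]\<close>)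
next
  case (step_Rec M)
  show ?case by (rule step_RecE[OF step_Rec(1)]) simp_all
next
  case (step_CaseLeft M L R)
  show ?case by (rule step_CaseLRE[OF step_CaseLeft(1)]) (simp_all add: whnf_no_step)
next
  case (step_CaseRight M L R)
  show ?case by (rule step_CaseLRE[OF step_CaseRight(1)]) (simp_all add: whnf_no_step)
next
  case (step_CasePair M\<^sub>1 M\<^sub>2 N)
  show ?case by (rule step_CasePairE[OF step_CasePair(1)]) (simp_all add: whnf_no_step)
next
  case (step_CaseAmb M\<^sub>1 M\<^sub>2 N)
  show ?case by (rule step_CaseAmbE[OF step_CaseAmb(1)]) (simp_all add: whnf_no_step)
next
  case (step_in_CaseLR M M' L R)
  have ne: "den M \<eta> \<noteq> \<bottom>"
    using step_in_CaseLR.prems(2) by (rule contrapos_nn) (rule den_strict_args(3))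
  have n: "\<not> con_headed M" "\<not> whnf M"
    using whnf_no_step con_headed_whnf step_in_CaseLR.hyps by blast+
  show ?case
    by (rule step_CaseLRE[OF step_in_CaseLR.prems(1)]) (use n in \<open>auto dest: step_in_CaseLR.IH[OF _ ne]\<close>)
next
  case (step_in_CasePair M M' N)
  have ne: "den M \<eta> \<noteq> \<bottom>"
    using step_in_CasePair.prems(2) by (rule contrapos_nn) (rule den_strict_args(4))
  have n: "\<not> con_headed M" "\<not> whnf M"
    using whnf_no_step con_headed_whnf step_in_CasePair.hyps by blast+
  show ?case
    by (rule step_CasePairE[OF step_in_CasePair.prems(1)]) (use n in \<open>auto dest: step_in_CasePair.IH[OF _ ne]\<close>)
next
  case (step_in_CaseAmb M M' N)
  have ne: "den M \<eta> \<noteq> \<bottom>"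
    using step_in_CaseAmb.prems(2) by (rule contrapos_nn) (rule den_strict_args(5))
  have n: "\<not> con_headed M" "\<not> whnf M"
    using whnf_no_step con_headed_whnf step_in_CaseAmb.hyps by blast+
  show ?case
    by (rule step_CaseAmbE[OF step_in_CaseAmb.prems(1)]) (use n in \<open>auto dest: step_in_CaseAmb.IH[OF _ ne]\<close>)
qed

section \<open>Evaluation to weak head normal form\<close>

definition evals :: "prog \<Rightarrow> prog \<Rightarrow> bool" (infix "\<Down>" 50) where
  "M \<Down> V \<longleftrightarrow> step\<^sup>*\<^sup>* M V \<and> whnf V"

lemma evals_whnf: "whnf V \<Longrightarrow> V \<Down> V"
  by (simp add: evals_def)

lemma den_steps: "step\<^sup>*\<^sup>* M M' \<Longrightarrow> den M \<eta> = den M' \<eta>"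
  by (induction rule: rtranclp_induct) (simp_all add: den_step)

lemma den_evals: "M \<Down> V \<Longrightarrow> den M \<eta> \<noteq> \<bottom>"
  using den_steps den_whnf by (metis evals_def)

lemma steps_evals: "step\<^sup>*\<^sup>* M M' \<Longrightarrow> M' \<Down> V \<Longrightarrow> M \<Down> V"
  by (auto simp: evals_def)

text \<open>A program with a value has a non-bottom denotation, so its reduction is deterministic
  and the given step is the first one on the way to \<open>V\<close>.\<close>

lemma step_evals_rev:
  assumes "M \<leadsto> M'" "M \<Down> V"
  shows "M' \<Down> V"
proof -
  from assms(2) have "step\<^sup>*\<^sup>* M V" "whnf V" by (simp_all add: evals_def)
  then obtain K where "M \<leadsto> K" "step\<^sup>*\<^sup>* K V"
    using whnf_no_step assms(1) by (metis converse_rtranclpE)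
  with \<open>whnf V\<close> show ?thesis
    using step_deterministic[OF assms(1), of K] den_evals[OF assms(2)] by (auto simp: evals_def)
qed

lemma steps_evals_rev: "step\<^sup>*\<^sup>* M M' \<Longrightarrow> M \<Down> V \<Longrightarrow> M' \<Down> V"
  by (induction rule: rtranclp_induct) (simp_all add: step_evals_rev)

lemma evals_unique:
  assumes "M \<Down> V" "M \<Down> W"
  shows "V = W"
proof -
  have "step\<^sup>*\<^sup>* V W" using steps_evals_rev[of M V W] assms by (simp add: evals_def)
  then show ?thesis
    using whnf_no_step assms(1) by (metis converse_rtranclpE evals_def)
qed

text \<open>By determinism the infinite sequence follows the finite reduction to \<open>V\<close>
  and would have to continue from \<open>V\<close>, which is irreducible.\<close>

lemma no_infinite_reduction:
  assumes "M \<Down> V" "S 0 = M" "\<And>i. S i \<leadsto> S (Suc i)"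
  shows False
proof -
  have "step\<^sup>*\<^sup>* M V" "whnf V" using assms(1) by (simp_all add: evals_def)
  from this assms(2,3) show False
  proof (induction arbitrary: S rule: converse_rtranclp_induct)
    case base
    then show ?case using whnf_no_step by metis
  next
    case (step M K)
    have "K \<Down> V" using step.hyps step.prems(1) by (simp add: evals_def)
    then have "den K (\<lambda>_. \<bottom>) \<noteq> \<bottom>" by (rule den_evals)
    then have "den M (\<lambda>_. \<bottom>) \<noteq> \<bottom>" using den_step[OF step.hyps(1)] by simp
    moreover have "M \<leadsto> S (Suc 0)" using step.prems(2,3) by metis
    ultimately have "S (Suc 0) = K" using step_deterministic step.hyps(1) by blast
    then show ?case using step.IH[of "\<lambda>i. S (Suc i)"] step.prems by blast
  qed
qed


section \<open>Computational adequacy\<close>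

text \<open>Meant for weak head normal forms, where the default case is a
  lambda-abstraction.\<close>

fun head :: "prog \<Rightarrow> tag" where
  "head NilP = NilT"
| "head (LeftP M) = LeftT"
| "head (RightP M) = RightT"
| "head (PairP M N) = PairT"
| "head (AmbP M N) = AmbT"
| "head _ = FunT"

fun args :: "prog \<Rightarrow> prog list" where
  "args (LeftP M) = [M]"
| "args (RightP M) = [M]"
| "args (PairP M N) = [M, N]"
| "args (AmbP M N) = [M, N]"
| "args _ = []"

lemma whnf_head:
  assumes "whnf V"
  shows "head V = NilT \<longleftrightarrow> V = NilP" "head V = LeftT \<longleftrightarrow> (\<exists>M. V = LeftP M)"
    "head V = RightT \<longleftrightarrow> (\<exists>M. V = RightP M)" "head V = PairT \<longleftrightarrow> (\<exists>M N. V = PairP M N)"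
    "head V = AmbT \<longleftrightarrow> (\<exists>M N. V = AmbP M N)" "head V = FunT \<longleftrightarrow> (\<exists>M. V = Lam M)"
  using assms by (auto simp: whnf_iff)

text \<open>
  The domain equation has \<open>D\<close> in negative position, so a logical relation between \<open>D\<close> and programs
  cannot be defined by recursion on types; it is defined by recursion on tokens instead.
\<close>

function realizes :: "tok \<Rightarrow> prog \<Rightarrow> bool" where
  "realizes (Tag c) M \<longleftrightarrow> (\<exists>V. M \<Down> V \<and> head V = c)"
| "realizes (Arg c i t) M \<longleftrightarrow> (\<exists>V. M \<Down> V \<and> head V = c \<and> realizes t (args V ! i))"
| "realizes (Step xs t) M \<longleftrightarrow>
    (\<exists>N. M \<Down> Lam N \<and> (\<forall>P. (\<forall>x\<in>set xs. realizes x P) \<longrightarrow> realizes t (subst1 N P)))"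
  by pat_completeness auto
termination
  \<comment> \<open>The program changes arbitrarily in the recursive calls, so only the token is
    measured.\<close>
  by (relation "measure (\<lambda>(t, M). size t)") (use size_mem_Step in auto)

lemma realizes_evals: "realizes t M \<Longrightarrow> \<exists>V. M \<Down> V \<and> head V = tag_of t"
  by (cases t) fastforce+

text \<open>\<open>realizes\<close> inspects a program only through its value, which is kept by
  expansion and, thanks to determinism, also by reduction.\<close>

lemma realizes_steps: "step\<^sup>*\<^sup>* M M' \<Longrightarrow> realizes t M \<longleftrightarrow> realizes t M'"
  using steps_evals[of M M'] steps_evals_rev[of M M'] by (cases t) (simp; blast)+

text \<open>Tokens realized separately can be combined because values are unique: all of them speak
  about the same arguments or the same function body.\<close>

lemma realizes_entails: "X \<turnstile> t \<Longrightarrow> (\<And>x. x \<in> X \<Longrightarrow> realizes x M) \<Longrightarrow> realizes t M"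
proof (induction arbitrary: M rule: entails.induct)
  case (Tag t X)
  then show ?case using realizes_evals by auto
next
  case (Arg c i X t)
  obtain s where "Arg c i s \<in> X" using entails_tag_of[OF Arg.hyps] by blast
  then obtain V where V: "M \<Down> V" "head V = c" using Arg.prems by fastforce
  have "realizes t (args V ! i)"
  proof (rule Arg.IH)
    fix s assume "s \<in> {t. Arg c i t \<in> X}"
    then show "realizes s (args V ! i)" using Arg.prems[of "Arg c i s"] V evals_unique by auto
  qed
  with V show ?case by auto
next
  case (Step Y t X xs)
  obtain y where "y \<in> Y" using entails_tag_of[OF Step.hyps] by blast
  then obtain zs where "Step zs y \<in> X" using Step.IH(2) by blast
  then obtain N where N: "M \<Down> Lam N" using Step.prems by fastforce
  have "realizes t (subst1 N P)" if P: "\<forall>x\<in>set xs. realizes x P" for P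
  proof (rule Step.IH(1))
    fix y assume "y \<in> Y"
    \<comment> \<open>Contravariance: since \<open>xs\<close> entails \<open>zs\<close>, the
      induction hypothesis lets \<open>P\<close> realize \<open>zs\<close> too.\<close>
    then obtain zs where zs: "Step zs y \<in> X" "\<forall>z\<in>set zs. realizes z P"
      using Step.IH(2) P by blast
    obtain N' where N': "M \<Down> Lam N'"
      "\<forall>P. (\<forall>x\<in>set zs. realizes x P) \<longrightarrow> realizes y (subst1 N' P)"
      using Step.prems[OF zs(1)] by auto
    have "N' = N" using evals_unique[OF N N'(1)] by simp
    then show "realizes y (subst1 N P)" using N'(2) zs(2) by blast
  qed
  with N show ?case by auto
qed

section \<open>The logical relation between domain elements and programs\<close>

definition approx :: "D \<Rightarrow> prog \<Rightarrow> bool" where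
  "approx d M \<longleftrightarrow> (\<forall>t\<in>toks d. realizes t M)"

lemma approxI: "(\<And>t. t \<in> toks d \<Longrightarrow> realizes t M) \<Longrightarrow> approx d M"
  by (simp add: approx_def)

lemma approxD: "approx d M \<Longrightarrow> t \<in> toks d \<Longrightarrow> realizes t M"
  by (simp add: approx_def)

lemma approx_bot [simp]: "approx \<bottom> M"
  by (simp add: approx_def)

lemma approx_steps: "step\<^sup>*\<^sup>* M M' \<Longrightarrow> approx d M \<longleftrightarrow> approx d M'"
  using realizes_steps by (simp add: approx_def)

text \<open>\<open>el xs\<close> contains only tokens entailed by \<open>xs\<close>. This turns the
  premise on \<open>P\<close> in the \<open>Step\<close> clause of \<open>realizes\<close> into an
  approximation.\<close>

lemma approx_el: "consis (set xs) \<Longrightarrow> (\<And>x. x \<in> set xs \<Longrightarrow> realizes x M) \<Longrightarrow> approx (el xs) M"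
  by (rule approxI) (auto simp: toks_el clos_def intro: realizes_entails)

lemma approx_evals:
  assumes "approx d M" "d \<noteq> \<bottom>"
  obtains V where "M \<Down> V"
proof -
  obtain t where "t \<in> toks d" using assms(2) D_eqI[of d \<bottom>] by auto
  then show ?thesis using approxD[OF assms(1)] realizes_evals that by blast
qed

lemma approx_Tag:
  assumes "approx d M" "Tag c \<in> toks d"
  obtains V where "M \<Down> V" "head V = c"
  using approxD[OF assms] by auto

lemma approx_argD:
  assumes "approx d M" "M \<Down> V"
  shows "approx (argD c i d) (args V ! i)"
proof (rule approxI)
  fix t assume "t \<in> toks (argD c i d)"
  then have "realizes (Arg c i t) M" by (intro approxD[OF assms(1)]) (simp add: toks_argD)
  then show "realizes t (args V ! i)" using evals_unique assms(2) by auto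
qed

lemma approx_con:
  assumes "whnf V" "toks d = con_toks (head V) ds"
    and "\<And>i. i < length ds \<Longrightarrow> approx (ds ! i) (args V ! i)"
  shows "approx d V"
proof (rule approxI)
  fix t assume "t \<in> toks d"
  then consider "t = Tag (head V)"
    | i s where "t = Arg (head V) i s" "i < length ds" "s \<in> toks (ds ! i)"
    unfolding assms(2) by (auto simp: con_toks_def)
  then show "realizes t V"
    using evals_whnf[OF assms(1)] approxD[OF assms(3)] by cases auto
qed

lemma approx_fun_of:
  assumes "approx u M" "M \<Down> Lam K" "approx d N"
  shows "approx (fun_of u d) (subst1 K N)"
proof (rule approxI)
  fix t assume "t \<in> toks (fun_of u d)"
  then obtain xs where xs: "Step xs t \<in> toks u" "set xs \<subseteq> toks d" by (auto simp: toks_fun_of)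
  obtain K' where K': "M \<Down> Lam K'"
    "\<forall>P. (\<forall>x\<in>set xs. realizes x P) \<longrightarrow> realizes t (subst1 K' P)"
    using approxD[OF assms(1) xs(1)] by auto
  have "K' = K" using evals_unique[OF assms(2) K'(1)] by simp
  then show "realizes t (subst1 K N)" using K'(2) xs(2) approxD[OF assms(3)] by blast
qed

lemma steps_cong:
  assumes "step\<^sup>*\<^sup>* M M'" "\<And>K K'. K \<leadsto> K' \<Longrightarrow> f K \<leadsto> f K'"
  shows "step\<^sup>*\<^sup>* (f M) (f M')"
  using assms(1) by (induction rule: rtranclp_induct) (auto intro: assms(2) rtranclp.rtrancl_into_rtrancl)

text \<open>If \<open>u\<close> is not a function then \<open>fun_of u d\<close> is bottom;
  otherwise the token \<open>Tag FunT\<close> forces \<open>M\<close> to evaluate to an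
  abstraction.\<close>

lemma approx_App:
  assumes M: "approx u M" and N: "approx d N"
  shows "approx (fun_of u d) (App M N)"
proof (cases "Tag FunT \<in> toks u")
  case True
  then obtain K where K: "M \<Down> Lam K"
    using approx_Tag[OF M] whnf_head(6) by (metis evals_def)
  then have "step\<^sup>*\<^sup>* (App M N) (App (Lam K) N)"
    using steps_cong[of M "Lam K" "\<lambda>M. App M N"] step_App by (auto simp: evals_def)
  then have "step\<^sup>*\<^sup>* (App M N) (subst1 K N)" using step_beta by (metis rtranclp.rtrancl_into_rtrancl)
  then show ?thesis using approx_fun_of[OF M K N] approx_steps by blast
qed (simp add: fun_of_bot)

text \<open>The reduction follows the order of the rules: first the argument, which has a value
  because \<open>d\<close> is not bottom, then the function, then strict beta.\<close>

lemma approx_SApp: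
  assumes M: "approx u M" and N: "approx d N" and "d \<noteq> \<bottom>"
  shows "approx (fun_of u d) (SApp M N)"
proof (cases "Tag FunT \<in> toks u")
  case True
  then obtain K where K: "M \<Down> Lam K"
    using approx_Tag[OF M] whnf_head(6) by (metis evals_def)
  obtain V where V: "N \<Down> V" using approx_evals[OF N \<open>d \<noteq> \<bottom>\<close>] .
  have "step\<^sup>*\<^sup>* (SApp M N) (SApp M V)"
    using V steps_cong[of N V "SApp M"] step_SApp2 by (auto simp: evals_def)
  also have "step\<^sup>*\<^sup>* (SApp M V) (SApp (Lam K) V)"
    using K V steps_cong[of M "Lam K" "\<lambda>M. SApp M V"] step_SApp1 by (auto simp: evals_def)
  also have "step\<^sup>*\<^sup>* (SApp (Lam K) V) (subst1 K V)"
    using V step_sbeta by (auto simp: evals_def)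
  finally have "step\<^sup>*\<^sup>* (SApp M N) (subst1 K V)" .
  moreover have "approx d V" using N V approx_steps by (auto simp: evals_def)
  ultimately show ?thesis using approx_fun_of[OF M K, of d V] approx_steps by blast
qed (simp add: fun_of_bot)

text \<open>Each token of the supremum already lies in a finite iterate, and every iterate costs one
  unfolding of \<open>Rec M\<close>.\<close>

lemma approx_Rec:
  assumes M: "approx u M"
  shows "approx (\<Squnion>n. (fun_of u ^^ n) \<bottom>) (Rec M)"
proof (rule approxI)
  have it: "approx ((fun_of u ^^ n) \<bottom>) (Rec M)" for n
  proof (induction n)
    case (Suc n)
    have "step\<^sup>*\<^sup>* (Rec M) (App M (Rec M))" using step_Rec by blast
    then show ?case using approx_App[OF M Suc] approx_steps by simp
  qed simp
  fix t assume "t \<in> toks (\<Squnion>n. (fun_of u ^^ n) \<bottom>)"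
  then obtain n where "t \<in> toks ((fun_of u ^^ n) \<bottom>)"
    using toks_Sup[OF chain_range_nat[OF LEAST_fixp(1)[OF cont_fun_of[of u]]]] by auto
  then show "realizes t (Rec M)" by (rule approxD[OF it])
qed

lemma approx_case_nat:
  "approx d N \<Longrightarrow> (\<And>n. approx (\<eta> n) (s n)) \<Longrightarrow> approx (case_nat d \<eta> n) (case_nat N s n)"
  by (cases n) simp_all

text \<open>The fundamental lemma of the logical relation. Environment and substitution vary in the
  induction, so that both can be extended at binders.\<close>

lemma approx_den: "(\<And>n. approx (\<eta> n) (s n)) \<Longrightarrow> approx (den M \<eta>) (subst s M)"
proof (induction M arbitrary: \<eta> s)
  case (Lam M)
  show ?case
  proof (rule approxI)
    fix t assume "t \<in> toks (den (Lam M) \<eta>)"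
    then consider "t = Tag FunT"
      | xs t' where "t = Step xs t'" "consis (set xs)" "t' \<in> toks (den M (case_nat (el xs) \<eta>))"
      by (auto simp: toks_D fun_toks_def den_Lam_cont)
    then show "realizes t (subst s (Lam M))"
    proof cases
      case 1
      then show ?thesis using evals_whnf[of "subst s (Lam M)"] by auto
    next
      case 2
      \<comment> \<open>The denotation of the body is taken at the argument \<open>el xs\<close>,
        and \<open>P\<close> approximates \<open>el xs\<close> by \<open>approx_el\<close>.\<close>
      have "realizes t' (subst1 (subst (up_subst s) M) P)" if "\<forall>x\<in>set xs. realizes x P" for P
        unfolding subst1_up_subst
        by (rule approxD[OF Lam.IH 2(3)], rule approx_case_nat)
          (use that Lam.prems approx_el[OF 2(2)] in auto)
      then show ?thesis using evals_whnf[of "subst s (Lam M)"] 2(1) by auto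
    qed
  qed
next
  case (App M N)
  then show ?case by (simp add: case_fun_of approx_App)
next
  case (SApp M N)
  then show ?case unfolding den.simps case_SApp by (simp add: approx_SApp)
next
  case (Rec M)
  then show ?case unfolding den.simps case_rec by (simp add: approx_Rec)
next
  case NilP
  show ?case by (rule approx_con[where ds = "[]"]) (simp_all add: toks_D)
next
  case (LeftP M)
  show ?case by (rule approx_con[where ds = "[den M \<eta>]"]) (simp_all add: toks_D LeftP)
next
  case (RightP M)
  show ?case by (rule approx_con[where ds = "[den M \<eta>]"]) (simp_all add: toks_D RightP)
next
  case (PairP M N)
  show ?case
    by (rule approx_con[where ds = "[den M \<eta>, den N \<eta>]"])
      (auto simp: toks_D PairP less_Suc_eq)
next
  case (AmbP M N)
  show ?case
    by (rule approx_con[where ds = "[den M \<eta>, den N \<eta>]"])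
      (auto simp: toks_D AmbP less_Suc_eq)
next
  case (CaseLR M L R)
  have M: "approx (den M \<eta>) (subst s M)" using CaseLR by blast
  show ?case
  proof (cases "den M \<eta>")
    case (DLeft d)
    \<comment> \<open>The tag of the denotation forces a value matching the clause. Where no clause
      matches, the case expression denotes bottom and every program approximates it.\<close>
    then obtain V where V: "subst s M \<Down> V" "head V = LeftT"
      using approx_Tag[OF M] by (auto simp: Tag_mem_D)
    then obtain N where N: "V = LeftP N" using whnf_head(2) by (auto simp: evals_def)
    have d: "approx d N" using approx_argD[OF M V(1), of LeftT 0] DLeft N by (simp add: argD_simps)
    have "step\<^sup>*\<^sup>* (subst s (CaseLR M L R))
        (CaseLR (LeftP N) (subst (up_subst s) L) (subst (up_subst s) R))"
      using V N steps_cong[of "subst s M" V "\<lambda>M. CaseLR M _ _"] step_in_CaseLR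
      by (auto simp: evals_def)
    then have "step\<^sup>*\<^sup>* (subst s (CaseLR M L R)) (subst (case_nat N s) L)"
      using step_CaseLeft subst1_up_subst by (metis rtranclp.rtrancl_into_rtrancl)
    moreover have "approx (den L (case_nat d \<eta>)) (subst (case_nat N s) L)"
      by (intro CaseLR.IH approx_case_nat d CaseLR.prems)
    ultimately show ?thesis using DLeft approx_steps by simp
  next
    case (DRight d)
    then obtain V where V: "subst s M \<Down> V" "head V = RightT"
      using approx_Tag[OF M] by (auto simp: Tag_mem_D)
    then obtain N where N: "V = RightP N" using whnf_head(3) by (auto simp: evals_def)
    have d: "approx d N" using approx_argD[OF M V(1), of RightT 0] DRight N by (simp add: argD_simps)
    have "step\<^sup>*\<^sup>* (subst s (CaseLR M L R))
        (CaseLR (RightP N) (subst (up_subst s) L) (subst (up_subst s) R))"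
      using V N steps_cong[of "subst s M" V "\<lambda>M. CaseLR M _ _"] step_in_CaseLR
      by (auto simp: evals_def)
    then have "step\<^sup>*\<^sup>* (subst s (CaseLR M L R)) (subst (case_nat N s) R)"
      using step_CaseRight subst1_up_subst by (metis rtranclp.rtrancl_into_rtrancl)
    moreover have "approx (den R (case_nat d \<eta>)) (subst (case_nat N s) R)"
      by (intro CaseLR.IH approx_case_nat d CaseLR.prems)
    ultimately show ?thesis using DRight approx_steps by simp
  qed simp_all
next
  case (CasePair M K)
  have M: "approx (den M \<eta>) (subst s M)" using CasePair by blast
  show ?case
  proof (cases "den M \<eta>")
    case (DPair d e)
    then obtain V where V: "subst s M \<Down> V" "head V = PairT"
      using approx_Tag[OF M] by (auto simp: Tag_mem_D)
    then obtain N N' where N: "V = PairP N N'" using whnf_head(4) by (auto simp: evals_def)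
    have d: "approx d N" "approx e N'"
      using approx_argD[OF M V(1), of PairT 0] approx_argD[OF M V(1), of PairT "Suc 0"] DPair N
      by (simp_all add: argD_simps)
    have "step\<^sup>*\<^sup>* (subst s (CasePair M K))
        (CasePair (PairP N N') (subst (up_subst (up_subst s)) K))"
      using V N steps_cong[of "subst s M" V "\<lambda>M. CasePair M _"] step_in_CasePair
      by (auto simp: evals_def)
    then have "step\<^sup>*\<^sup>* (subst s (CasePair M K)) (subst (case_nat N (case_nat N' s)) K)"
      using step_CasePair subst2_up_subst by (metis rtranclp.rtrancl_into_rtrancl)
    moreover have "approx (den K (case_nat d (case_nat e \<eta>))) (subst (case_nat N (case_nat N' s)) K)"
      by (intro CasePair.IH approx_case_nat d CasePair.prems)
    ultimately show ?thesis using DPair approx_steps by simp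
  qed simp_all
next
  case (CaseAmb M K)
  have M: "approx (den M \<eta>) (subst s M)" using CaseAmb by blast
  show ?case
  proof (cases "den M \<eta>")
    case (DAmb d e)
    then obtain V where V: "subst s M \<Down> V" "head V = AmbT"
      using approx_Tag[OF M] by (auto simp: Tag_mem_D)
    then obtain N N' where N: "V = AmbP N N'" using whnf_head(5) by (auto simp: evals_def)
    have d: "approx d N" "approx e N'"
      using approx_argD[OF M V(1), of AmbT 0] approx_argD[OF M V(1), of AmbT "Suc 0"] DAmb N
      by (simp_all add: argD_simps)
    have "step\<^sup>*\<^sup>* (subst s (CaseAmb M K))
        (CaseAmb (AmbP N N') (subst (up_subst (up_subst s)) K))"
      using V N steps_cong[of "subst s M" V "\<lambda>M. CaseAmb M _"] step_in_CaseAmb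
      by (auto simp: evals_def)
    then have "step\<^sup>*\<^sup>* (subst s (CaseAmb M K)) (subst (case_nat N (case_nat N' s)) K)"
      using step_CaseAmb subst2_up_subst by (metis rtranclp.rtrancl_into_rtrancl)
    moreover have "approx (den K (case_nat d (case_nat e \<eta>))) (subst (case_nat N (case_nat N' s)) K)"
      by (intro CaseAmb.IH approx_case_nat d CaseAmb.prems)
    ultimately show ?thesis using DAmb approx_steps by simp
  qed simp_all
qed simp_all

text \<open>Every substitution approximates the bottom environment, in particular
  \<open>Var\<close>, which leaves \<open>M\<close> unchanged. A non-bottom denotation contains a
  token, and a program realizing a token has a value.\<close>

theorem adequacy:
  assumes "den0 M \<noteq> \<bottom>"
  shows "\<exists>V. M \<Down> V"
proof -
  have "approx (den0 M) M" using approx_den[of "\<lambda>_. \<bottom>" Var M] by (simp add: den0_def)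
  then show ?thesis using approx_evals assms by blast
qed

lemma infinite_reduction_bot:
  assumes "\<And>i. S i \<leadsto> S (Suc i)"
  shows "den0 (S 0) = \<bottom>"
  using adequacy no_infinite_reduction[of "S 0"] assms by blast


section \<open>Fair computations\<close>

definition fair :: "(nat \<Rightarrow> prog) \<Rightarrow> bool" where
  "fair S \<longleftrightarrow> pseq S \<and> \<not> unfair S"

lemma pseqD: "pseq S \<Longrightarrow> S i \<leadsto>\<^sub>p S (Suc i)"
  by (simp add: pseq_def)

lemma pseq_add: "pseq S \<Longrightarrow> pseq (\<lambda>i. S (n + i))"
  by (simp add: pseq_def)

lemma unfair_add: "pseq S \<Longrightarrow> unfair (\<lambda>i. S (n + i)) \<Longrightarrow> unfair S"
proof (induction n arbitrary: S)
  case (Suc n)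
  have "pseq (\<lambda>i. S (Suc i))" using pseq_add[OF Suc.prems(1), of 1] by simp
  then have "unfair (\<lambda>i. S (Suc i))" by (rule Suc.IH) (use Suc.prems(2) in simp)
  then show ?case by (rule unfair_tail[OF Suc.prems(1)])
qed simp

lemma fair_add: "fair S \<Longrightarrow> fair (\<lambda>i. S (n + i))"
  unfolding fair_def using pseq_add unfair_add by blast

section \<open>Limits of observations\<close>

lemma mono_obs: "pseq S \<Longrightarrow> mono (\<lambda>i. obs (S i))"
  unfolding mono_iff_le_Suc using pseqD obs_mono by blast

lemma toks_SUP_obs: "pseq S \<Longrightarrow> toks (\<Squnion>i. obs (S i)) = (\<Union>i. toks (obs (S i)))"
  using toks_Sup[OF chain_range_nat[OF mono_obs]] by (simp add: image_image)

lemma SUP_obs_add: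
  assumes "pseq S"
  shows "(\<Squnion>i. obs (S (n + i))) = (\<Squnion>i. obs (S i))"
proof (rule D_eqI)
  fix t
  have "obs (S i) \<le> obs (S (n + i))" for i by (rule monoD[OF mono_obs[OF assms]]) simp
  then have "t \<in> toks (obs (S i)) \<Longrightarrow> t \<in> toks (obs (S (n + i)))" for i by (rule D_leD)
  then show "t \<in> toks (\<Squnion>i. obs (S (n + i))) \<longleftrightarrow> t \<in> toks (\<Squnion>i. obs (S i))"
    unfolding toks_SUP_obs[OF assms] toks_SUP_obs[OF pseq_add[OF assms]] by auto
qed

lemma SUP_obs_bot:
  assumes "pseq S" "\<And>i. obs (S i) = \<bottom>"
  shows "(\<Squnion>i. obs (S i)) = \<bottom>"
  by (rule D_eqI) (simp add: toks_SUP_obs assms)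

text \<open>Compared token by token: the tag occurs at every index, and an argument token occurs in
  the limit iff it occurs at some index.\<close>

lemma SUP_obs_con:
  assumes "pseq S"
  shows "pseq N \<Longrightarrow> (\<And>i. S i = LeftP (N i)) \<Longrightarrow> (\<Squnion>i. obs (S i)) = DLeft (\<Squnion>i. obs (N i))"
    and "pseq N \<Longrightarrow> (\<And>i. S i = RightP (N i)) \<Longrightarrow> (\<Squnion>i. obs (S i)) = DRight (\<Squnion>i. obs (N i))"
    and "pseq N \<Longrightarrow> pseq N' \<Longrightarrow> (\<And>i. S i = PairP (N i) (N' i)) \<Longrightarrow>
      (\<Squnion>i. obs (S i)) = DPair (\<Squnion>i. obs (N i)) (\<Squnion>i. obs (N' i))"
  by (rule D_eqI; unfold toks_SUP_obs[OF assms]; auto simp: toks_D con_toks_def toks_SUP_obs less_Suc_eq)+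

section \<open>Parallel steps from weak head normal forms and fairness of components\<close>

inductive_cases pstep_NilE: "NilP \<leadsto>\<^sub>p K"
inductive_cases pstep_LeftE: "LeftP M \<leadsto>\<^sub>p K"
inductive_cases pstep_RightE: "RightP M \<leadsto>\<^sub>p K"
inductive_cases pstep_PairE: "PairP M N \<leadsto>\<^sub>p K"
inductive_cases pstep_AmbE: "AmbP M N \<leadsto>\<^sub>p K"
inductive_cases pstep_LamE: "Lam M \<leadsto>\<^sub>p K"

text \<open>Every rule other than plain reduction starts from a weak head normal form.\<close>

lemma pstep_not_whnf: "M \<leadsto>\<^sub>p M' \<Longrightarrow> \<not> whnf M \<Longrightarrow> M \<leadsto> M'"
  by (erule pstep.cases) (auto elim: cstep.cases)

lemma pstep_NilD: "NilP \<leadsto>\<^sub>p K \<Longrightarrow> K = NilP"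
  by (auto elim!: pstep_NilE cstep.cases simp: whnf_no_step)

lemma pstep_LamD: "Lam M \<leadsto>\<^sub>p K \<Longrightarrow> K = Lam M"
  by (auto elim!: pstep_LamE cstep.cases simp: whnf_no_step)

lemma pstep_LeftD: "LeftP M \<leadsto>\<^sub>p K \<Longrightarrow> \<exists>M'. K = LeftP M' \<and> M \<leadsto>\<^sub>p M'"
  by (auto elim!: pstep_LeftE cstep.cases simp: whnf_no_step)

lemma pstep_RightD: "RightP M \<leadsto>\<^sub>p K \<Longrightarrow> \<exists>M'. K = RightP M' \<and> M \<leadsto>\<^sub>p M'"
  by (auto elim!: pstep_RightE cstep.cases simp: whnf_no_step)

lemma pstep_PairD:
  "PairP M N \<leadsto>\<^sub>p K \<Longrightarrow> \<exists>M' N'. K = PairP M' N' \<and> M \<leadsto>\<^sub>p M' \<and> N \<leadsto>\<^sub>p N'"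
  by (auto elim!: pstep_PairE cstep.cases simp: whnf_no_step)

lemma pstep_Amb_cases:
  assumes "AmbP L R \<leadsto>\<^sub>p K"
  obtains (left) L' where "L \<leadsto> L'" "K = AmbP L' R"
    | (right) R' where "R \<leadsto> R'" "K = AmbP L R'"
    | (choose_left) "whnf L" "K = L"
    | (choose_right) "whnf R" "K = R"
  using assms by (auto elim!: pstep_AmbE cstep.cases simp: whnf_no_step)

text \<open>Parallel steps never remove a data constructor, and an unfair component would make the
  whole sequence unfair.\<close>

lemma fair_Left:
  assumes S: "fair S" and "S 0 = LeftP M"
  obtains N where "N 0 = M" "\<And>i. S i = LeftP (N i)" "fair N"
proof -
  have p: "pseq S" using S by (simp add: fair_def)
  have "\<exists>N. S i = LeftP N" for i
    by (induction i) (use assms pstep_LeftD pseqD[OF p] in metis)+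
  then obtain N where N: "\<And>i. S i = LeftP (N i)" by metis
  then have "pseq N" using pseqD[OF p] pstep_LeftD unfolding pseq_def by (metis prog.inject)
  moreover have "\<not> unfair N" using unfair_Left[OF p N] S by (auto simp: fair_def)
  ultimately show ?thesis using that N assms(2) by (simp add: fair_def)
qed

lemma fair_Right:
  assumes S: "fair S" and "S 0 = RightP M"
  obtains N where "N 0 = M" "\<And>i. S i = RightP (N i)" "fair N"
proof -
  have p: "pseq S" using S by (simp add: fair_def)
  have "\<exists>N. S i = RightP N" for i
    by (induction i) (use assms pstep_RightD pseqD[OF p] in metis)+
  then obtain N where N: "\<And>i. S i = RightP (N i)" by metis
  then have "pseq N" using pseqD[OF p] pstep_RightD unfolding pseq_def by (metis prog.inject)
  moreover have "\<not> unfair N" using unfair_Right[OF p N] S by (auto simp: fair_def)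
  ultimately show ?thesis using that N assms(2) by (simp add: fair_def)
qed

lemma fair_Pair:
  assumes S: "fair S" and "S 0 = PairP M M'"
  obtains N N' where "N 0 = M" "N' 0 = M'" "\<And>i. S i = PairP (N i) (N' i)" "fair N" "fair N'"
proof -
  have p: "pseq S" using S by (simp add: fair_def)
  have "\<exists>N N'. S i = PairP N N'" for i
    by (induction i) (use assms pstep_PairD pseqD[OF p] in metis)+
  then obtain N N' where N: "\<And>i. S i = PairP (N i) (N' i)" by metis
  then have "PairP (N i) (N' i) \<leadsto>\<^sub>p PairP (N (Suc i)) (N' (Suc i))" for i using pseqD[OF p] by metis
  then have "pseq N" "pseq N'" using pstep_PairD unfolding pseq_def by (metis prog.inject)+
  moreover have "\<not> unfair N" "\<not> unfair N'"
    using unfair_Pair1[OF p N] unfair_Pair2[OF p N] S by (auto simp: fair_def)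
  ultimately show ?thesis using that[of N N'] N assms(2) by (simp add: fair_def)
qed

text \<open>Deleting the stationary positions leaves an infinite reduction from \<open>L 0\<close>,
  which therefore has no value.\<close>

lemma bot_of_infinitely_many_steps:
  assumes eq_or_step: "\<And>i. L i = L (Suc i) \<or> L i \<leadsto> L (Suc i)"
    and inf: "\<And>n. \<exists>i\<ge>n. L i \<leadsto> L (Suc i)"
  shows "den0 (L 0) = \<bottom>"
proof (rule ccontr)
  assume "den0 (L 0) \<noteq> \<bottom>"
  then obtain V where V: "L 0 \<Down> V" using adequacy by blast
  have ex: "\<exists>i\<ge>n. L i = L n \<and> L i \<leadsto> L (Suc i)" for n
  proof -
    obtain i where i: "n \<le> i" "L i \<leadsto> L (Suc i)" using inf by blast
    \<comment> \<open>The first reduction at or after \<open>n\<close>; by minimality the sequence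
      is stationary between \<open>n\<close> and \<open>m\<close>.\<close>
    define m where "m = (LEAST i. n \<le> i \<and> L i \<leadsto> L (Suc i))"
    have m: "n \<le> m \<and> L m \<leadsto> L (Suc m)" unfolding m_def by (rule LeastI) (use i in blast)
    have "L (n + k) = L n" if "n + k \<le> m" for k
      using that
    proof (induction k)
      case (Suc k)
      then have "\<not> L (n + k) \<leadsto> L (Suc (n + k))"
        using not_less_Least[of "n + k" "\<lambda>i. n \<le> i \<and> L i \<leadsto> L (Suc i)"] by (auto simp: m_def)
      then show ?case using Suc eq_or_step[of "n + k"] by simp
    qed simp
    then have "L m = L n" using m by (metis le_add_diff_inverse order_refl)
    then show ?thesis using m by blast
  qed
  then obtain g where g: "\<And>n. n \<le> g n \<and> L (g n) = L n \<and> L (g n) \<leadsto> L (Suc (g n))" by metis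
  \<comment> \<open>\<open>h\<close> starts at 0 and then lists positions just after successive
    reductions; as \<open>L (g n) = L n\<close>, each \<open>L (h k)\<close> reduces to the next in
    one step.\<close>
  define h where "h k = ((\<lambda>n. Suc (g n)) ^^ k) 0" for k
  have "L n \<leadsto> L (Suc (g n))" for n using g[of n] by metis
  then have "L (h k) \<leadsto> L (h (Suc k))" for k by (simp add: h_def)
  then show False using no_infinite_reduction[OF V, of "\<lambda>k. L (h k)"] by (simp add: h_def)
qed

text \<open>
  If no branch of a fair computation starting with \<open>Amb\<close> is ever chosen then both arguments are
  reduced infinitely often, hence neither has a weak head normal form.
\<close>

lemma fair_Amb:
  assumes S: "fair S" and "S 0 = AmbP L R"
  obtains (left) k where "den0 (S k) = den0 L" "den0 L \<noteq> \<bottom>"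
    | (right) k where "den0 (S k) = den0 R" "den0 R \<noteq> \<bottom>"
    | (neither) "\<And>i. obs (S i) = \<bottom>" "den0 L = \<bottom>" "den0 R = \<bottom>"
proof -
  have p: "pseq S" using S by (simp add: fair_def)
  \<comment> \<open>The steps inside one argument; by \<open>pstep_Amb_cases\<close> all other steps
    from \<open>AmbP\<close> are choices.\<close>
  define inner where "inner K K' \<longleftrightarrow> (\<exists>L L' R R'. K = AmbP L R \<and> K' = AmbP L' R' \<and>
      (L \<leadsto> L' \<and> R = R' \<or> L = L' \<and> R \<leadsto> R'))" for K K'
  show ?thesis
  proof (cases "\<forall>i. inner (S i) (S (Suc i))")
    case True
    then have "\<exists>L R. S i = AmbP L R" for i unfolding inner_def by metis
    then obtain l r where lr: "\<And>i. S i = AmbP (l i) (r i)" by metis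
    have steps: "l i \<leadsto> l (Suc i) \<and> r i = r (Suc i) \<or> l i = l (Suc i) \<and> r i \<leadsto> r (Suc i)" for i
      using True[rule_format, of i] by (auto simp: inner_def lr)
    \<comment> \<open>The \<open>Amb\<close> rules of \<open>unfair\<close> demand their pattern
      from index 0 on, so they are applied to tails.\<close>
    have fair: "\<not> unfair (\<lambda>i. AmbP (l (n + i)) (r (n + i)))" for n
      using fair_add[OF S, of n] by (simp add: fair_def lr)
    \<comment> \<open>Otherwise from \<open>n\<close> on only the left argument moves, the pattern
      of \<open>unfair_Amb1\<close>.\<close>
    have r: "\<exists>i\<ge>n. r i \<leadsto> r (Suc i)" for n
    proof (rule ccontr)
      assume "\<not> (\<exists>i\<ge>n. r i \<leadsto> r (Suc i))"
      then have n: "l (n + i) \<leadsto> l (Suc (n + i)) \<and> r (n + i) = r (Suc (n + i))" for i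
        using steps[of "n + i"] by auto
      have "r (n + i) = r n" for i
        by (induction i) (use n in \<open>metis add_0_right add_Suc_right\<close>)+
      then have "unfair (\<lambda>i. AmbP (l (n + i)) (r (n + i)))"
        by (intro unfair_Amb1[of _ "\<lambda>i. l (n + i)" "r n"]) (use n in simp_all)
      then show False using fair by blast
    qed
    have l: "\<exists>i\<ge>n. l i \<leadsto> l (Suc i)" for n
    proof (rule ccontr)
      assume "\<not> (\<exists>i\<ge>n. l i \<leadsto> l (Suc i))"
      then have n: "r (n + i) \<leadsto> r (Suc (n + i)) \<and> l (n + i) = l (Suc (n + i))" for i
        using steps[of "n + i"] by auto
      have "l (n + i) = l n" for i
        by (induction i) (use n in \<open>metis add_0_right add_Suc_right\<close>)+
      then have "unfair (\<lambda>i. AmbP (l (n + i)) (r (n + i)))"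
        by (intro unfair_Amb2[of _ "l n" "\<lambda>i. r (n + i)"]) (use n in simp_all)
      then show False using fair by blast
    qed
    have "den0 (l 0) = \<bottom>" "den0 (r 0) = \<bottom>"
      by (rule bot_of_infinitely_many_steps; use steps l r in blast)+
    then show ?thesis using neither lr assms(2) by simp
  next
    case False
    \<comment> \<open>The first step that is a choice; before it both arguments are only reduced and
      keep their denotations.\<close>
    then obtain k where k: "\<not> inner (S k) (S (Suc k))" "\<And>i. i < k \<Longrightarrow> inner (S i) (S (Suc i))"
      using exists_least_iff[of "\<lambda>k. \<not> inner (S k) (S (Suc k))"] by blast
    have "\<exists>L' R'. S i = AmbP L' R' \<and> step\<^sup>*\<^sup>* L L' \<and> step\<^sup>*\<^sup>* R R'" if "i \<le> k" for i
      using that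
    proof (induction i)
      case (Suc i)
      then obtain L' R' where "S i = AmbP L' R'" "step\<^sup>*\<^sup>* L L'" "step\<^sup>*\<^sup>* R R'" by auto
      then show ?case
        using k(2)[of i] Suc.prems by (auto simp: inner_def intro: rtranclp.rtrancl_into_rtrancl)
    qed (use assms(2) in simp)
    then obtain L' R' where K: "S k = AmbP L' R'" "step\<^sup>*\<^sup>* L L'" "step\<^sup>*\<^sup>* R R'" by blast
    have "AmbP L' R' \<leadsto>\<^sub>p S (Suc k)" using pseqD[OF p, of k] K(1) by simp
    then show ?thesis
    proof (cases rule: pstep_Amb_cases)
      \<comment> \<open>The chosen \<open>L'\<close> is a reduct of \<open>L\<close>, hence has the
        same denotation, and a weak head normal form, hence does not denote bottom.\<close>
      case choose_left
      then show ?thesis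
        using left[of "Suc k"] den_steps[OF K(2)] den_whnf[of L'] by (simp add: den0_def)
    next
      case choose_right
      then show ?thesis
        using right[of "Suc k"] den_steps[OF K(3)] den_whnf[of R'] by (simp add: den0_def)
    qed (use k(1) K(1) in \<open>auto simp: inner_def\<close>)
  qed
qed

text \<open>Up to the first weak head normal form all steps are plain reductions. If there is none,
  the sequence is an infinite reduction, and reducible programs have bottom observation.\<close>

lemma fair_whnf:
  assumes "fair S"
  obtains (whnf) n where "whnf (S n)" "den0 (S n) = den0 (S 0)"
    | (bot) "\<And>i. obs (S i) = \<bottom>" "den0 (S 0) = \<bottom>"
proof (cases "\<exists>n. whnf (S n)")
  case True
  then obtain n where n: "whnf (S n)" "\<And>i. i < n \<Longrightarrow> \<not> whnf (S i)"
    using exists_least_iff[of "\<lambda>n. whnf (S n)"] by blast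
  have "den0 (S i) = den0 (S 0)" if "i \<le> n" for i
    using that
  proof (induction i)
    case (Suc i)
    have "S i \<leadsto> S (Suc i)"
      using assms n(2) Suc.prems pstep_not_whnf pseqD by (simp add: fair_def)
    then show ?case using Suc den_step[of "S i"] by (simp add: den0_def)
  qed simp
  then show ?thesis using whnf n(1) by blast
next
  case False
  then have "S i \<leadsto> S (Suc i)" for i
    using assms pstep_not_whnf pseqD by (simp add: fair_def)
  then show ?thesis using bot step_obs infinite_reduction_bot by blast
qed

lemma in_data_fair:
  assumes "fair S"
  shows "in_data (\<Squnion>i. obs (S i)) (den0 (S 0))"
proof -
  \<comment> \<open>\<open>X\<close> ranges over all fair sequences, because the coinduction moves
    on to components and tails.\<close>
  define X where "X d a \<longleftrightarrow> (\<exists>S. fair S \<and> d = (\<Squnion>i. obs (S i)) \<and> a = den0 (S 0))" for d a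
  \<comment> \<open>The limit may be paired with the denotation at any index \<open>k\<close>, since
    dropping a prefix changes neither fairness nor the limit.\<close>
  have X_I: "X (\<Squnion>i. obs (S i)) (den0 (S k))" if "fair S" for S k
    unfolding X_def
    by (intro exI[of _ "\<lambda>i. S (k + i)"])
      (use that fair_add SUP_obs_add in \<open>auto simp: fair_def\<close>)
  have "X (\<Squnion>i. obs (S i)) (den0 (S 0))" using X_I assms by blast
  then show ?thesis
  proof (coinduct rule: in_data.coinduct)
    case (in_data d a)
    then obtain S where S: "fair S" "d = (\<Squnion>i. obs (S i))" "a = den0 (S 0)" by (auto simp: X_def)
    have p: "pseq S" using S(1) by (simp add: fair_def)
    from S(1) show ?case
    proof (cases rule: fair_whnf)
      case bot
      then show ?thesis using S SUP_obs_bot[OF p] by simp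
    next
      case (whnf n)
      define T where "T = (\<lambda>i. S (n + i))"
      have T: "fair T" "d = (\<Squnion>i. obs (T i))" "a = den0 (T 0)" "whnf (T 0)"
        using fair_add[OF S(1), of n] SUP_obs_add[OF p, of n] S whnf by (simp_all add: T_def)
      have pT: "pseq T" using T(1) by (simp add: fair_def)
      from T(4) consider "T 0 = NilP" | M where "T 0 = LeftP M" | M where "T 0 = RightP M"
        | M N where "T 0 = PairP M N" | L R where "T 0 = AmbP L R" | M where "T 0 = Lam M"
        by (auto simp: whnf_iff)
      then show ?thesis
      proof cases
        case 1
        have "T i = NilP" for i by (induction i) (use 1 pstep_NilD pseqD[OF pT] in metis)+
        then have "d = DNil" "a = DNil" using T(2,3) by (simp_all add: den0_def)
        then show ?thesis by simp
      next
        case (2 M)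
        obtain N where N: "N 0 = M" "\<And>i. T i = LeftP (N i)" "fair N"
          using fair_Left[OF T(1) 2] by blast
        have "d = DLeft (\<Squnion>i. obs (N i))"
          unfolding T(2) by (rule SUP_obs_con(1)[OF pT]) (use N in \<open>simp_all add: fair_def\<close>)
        moreover have "a = DLeft (den0 (N 0))" using T(3) N by (simp add: den0_def)
        ultimately show ?thesis using X_I[OF N(3), of 0] by simp
      next
        case (3 M)
        obtain N where N: "N 0 = M" "\<And>i. T i = RightP (N i)" "fair N"
          using fair_Right[OF T(1) 3] by blast
        have "d = DRight (\<Squnion>i. obs (N i))"
          unfolding T(2) by (rule SUP_obs_con(2)[OF pT]) (use N in \<open>simp_all add: fair_def\<close>)
        moreover have "a = DRight (den0 (N 0))" using T(3) N by (simp add: den0_def)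
        ultimately show ?thesis using X_I[OF N(3), of 0] by simp
      next
        case (4 M M')
        obtain N N' where N: "\<And>i. T i = PairP (N i) (N' i)" "fair N" "fair N'"
          using fair_Pair[OF T(1) 4] by blast
        have "d = DPair (\<Squnion>i. obs (N i)) (\<Squnion>i. obs (N' i))"
          unfolding T(2) by (rule SUP_obs_con(3)[OF pT]) (use N in \<open>simp_all add: fair_def\<close>)
        moreover have "a = DPair (den0 (N 0)) (den0 (N' 0))" using T(3) N by (simp add: den0_def)
        ultimately show ?thesis using X_I[OF N(2), of 0] X_I[OF N(3), of 0] by simp
      next
        case (5 L R)
        then have a: "a = DAmb (den0 L) (den0 R)" using T(3) by (simp add: den0_def)
        from T(1) 5 show ?thesis
        proof (cases rule: fair_Amb)
          \<comment> \<open>At index \<open>k\<close> the sequence denotes the non-bottom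
            \<open>den0 L\<close>, so its limit \<open>d\<close> is related by \<open>X\<close> to
            that argument of \<open>a\<close>.\<close>
          case (left k)
          then show ?thesis using a X_I[OF T(1), of k] T(2) by simp
        next
          case (right k)
          then show ?thesis using a X_I[OF T(1), of k] T(2) by simp
        next
          case neither
          then show ?thesis using a T(2) SUP_obs_bot[OF pT] by simp
        qed
      next
        case (6 M)
        have "T i = Lam M" for i by (induction i) (use 6 pstep_LamD pseqD[OF pT] in metis)+
        then show ?thesis using T(2,3) by (simp add: den0_def)
      qed
    qed
  qed
qed

theorem theorem3p2:
  fixes M :: prog and Ms :: "nat \<Rightarrow> prog"
  assumes "closed_prog M" and "computation M Ms"
  shows "(\<Squnion>i. obs (Ms i)) \<in> data (den0 M)"
  using in_data_fair[of Ms] assms(2) by (auto simp: computation_def fair_def data_def)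

end
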